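(* Let $F$ be a Generalized Flowerbed of size $n$ such that no blue and red Generalized Flower form a canceling pair and at least one of its blue or red Generalized Flowers has height at least $2$. Then $o^+(F)=o^-(F)$. Moreover, if $n\ge2$, then (for a given player to move first) the winning player can make their next move in such a way that they win under both normal and misère play.
   Context: Hackenbush: finite graph with blue, red or green edges and ground vertices; Left cuts blue or green edges, Right cuts red or green; components disconnected from the ground are discarded. Normal play: last mover wins; misère play: last mover loses; $o^+$, $o^-$ are the outcome classes ($\mathcal N,\mathcal P,\mathcal L,\mathcal R$). A Stalk of height $h$ is a path of $h$ green edges on the ground. A Generalized Flower $*_h:(x)$ is a green path of $h\ge1$ edges (stem) whose bottom vertex is the only ground vertex, with a red–blue Hackenbush position (Blossom) attached at the top vertex, $x$ being the normal-play value of the Blossom; it is blue if $x>0$, red if $x<0$. A Generalized Flowerbed of size $n$ is a disjunctive sum of $n$ blue Generalized Flowers, $n$ red Generalized Flowers and a (possibly empty) sum of Stalks. A blue and a red Generalized Flower cancel if they have the same height and blossom values $x$ and $-x$. *)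

theory Defs
  imports "HOL-Library.FSet" "HOL-Library.Uprod"
begin

section \<open>Short games, outcomes and normal-play values\<close>

datatype player = Left | Right

fun opponent :: "player \<Rightarrow> player" where
  "opponent Left = Right"
| "opponent Right = Left"

datatype convention = Normal | Misere

datatype game = Game (left_opts: "game fset") (right_opts: "game fset")

fun options :: "player \<Rightarrow> game \<Rightarrow> game fset" where
  "options Left G = left_opts G"
| "options Right G = right_opts G"

lemma size_fset_member: "x |\<in>| A \<Longrightarrow> f x < Suc (size_fset f A)"
proof -
  assume "x |\<in>| A"
  then have "(\<lambda>x. Suc (f x)) x \<le> (\<Sum>x\<in>fset A. Suc (f x))"
    by (intro member_le_sum) auto
  then show ?thesis by simp
qed

lemma size_opts: "H |\<in>| options p G \<Longrightarrow> size H < size G"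
  using size_fset_member[of H _ size] by (cases G; cases p) fastforce+

lemma size_left_option [termination_simp]: "H |\<in>| left_opts G \<Longrightarrow> size H < size G"
  and size_right_option [termination_simp]: "H |\<in>| right_opts G \<Longrightarrow> size H < size G"
  using size_opts[of H Left G] size_opts[of H Right G] by auto

text \<open>\<open>wins c p G\<close>: the player \<open>p\<close>, who is to move in \<open>G\<close>, wins under convention \<open>c\<close>.
  A player who cannot move loses in normal play and wins in misere play.\<close>

function wins :: "convention \<Rightarrow> player \<Rightarrow> game \<Rightarrow> bool" where
  "wins c p G \<longleftrightarrow>
     (c = Misere \<and> options p G = {||}) \<or> (\<exists>H |\<in>| options p G. \<not> wins c (opponent p) H)"
  by pat_completeness auto
termination
  by (relation "Wellfounded.measure (\<lambda>(c, p, G). size G)") (auto simp: size_opts)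

declare wins.simps [simp del]

datatype outcome = N_outcome | P_outcome | L_outcome | R_outcome

definition outcome :: "convention \<Rightarrow> game \<Rightarrow> outcome" where
  "outcome c G =
     (if wins c Left G
      then (if wins c Right G then N_outcome else L_outcome)
      else (if wins c Right G then R_outcome else P_outcome))"

text \<open>Outcomes are ordered by Left's preference; \<open>N_outcome\<close> and \<open>P_outcome\<close> are incomparable.\<close>

instantiation outcome :: order
begin
definition less_eq_outcome :: "outcome \<Rightarrow> outcome \<Rightarrow> bool" where
  "a \<le> b \<longleftrightarrow> a = b \<or> a = R_outcome \<or> b = L_outcome"
definition less_outcome :: "outcome \<Rightarrow> outcome \<Rightarrow> bool" where
  "a < b \<longleftrightarrow> a \<le> b \<and> \<not> b \<le> (a :: outcome)"
instance
  by standard (auto simp: less_eq_outcome_def less_outcome_def)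
end

function add_game :: "game \<Rightarrow> game \<Rightarrow> game" where
  "add_game G H = Game
     ((\<lambda>K. add_game K H) |`| left_opts G |\<union>| (\<lambda>K. add_game G K) |`| left_opts H)
     ((\<lambda>K. add_game K H) |`| right_opts G |\<union>| (\<lambda>K. add_game G K) |`| right_opts H)"
  by pat_completeness auto
termination
  by (relation "Wellfounded.measure (\<lambda>(G, H). size G + size H)")
    (auto simp: size_left_option size_right_option)

declare add_game.simps [simp del]

instantiation game :: "{zero, plus, uminus}"
begin
definition zero_game :: game where "0 = Game {||} {||}"
definition plus_game :: "game \<Rightarrow> game \<Rightarrow> game" where "G + H = add_game G H"
primrec uminus_game :: "game \<Rightarrow> game" where
  "- Game A B = Game (uminus |`| B) (uminus |`| A)"
instance ..
end

lemma plus_game_rec: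
  "G + H = Game
     ((\<lambda>K. K + H) |`| left_opts G |\<union>| (\<lambda>K. G + K) |`| left_opts H)
     ((\<lambda>K. K + H) |`| right_opts G |\<union>| (\<lambda>K. G + K) |`| right_opts H)"
  for G H :: game
  unfolding plus_game_def by (subst add_game.simps) simp

lemma options_plus:
  "options p (G + H) = (\<lambda>K. K + H) |`| options p G |\<union>| (\<lambda>K. G + K) |`| options p H"
  by (cases p) (subst plus_game_rec, simp)+

lemma options_zero [simp]: "options p 0 = {||}"
  by (cases p) (simp_all add: zero_game_def)

lemma options_uminus: "options p (- G) = uminus |`| options (opponent p) G"
  by (cases G; cases p) simp_all

lemma game_eqI: "(\<And>p. options p G = options p H) \<Longrightarrow> G = H"
  by (metis options.simps game.expand)

lemma fimage_cong': "(\<And>x. x |\<in>| A \<Longrightarrow> f x = g x) \<Longrightarrow> f |`| A = g |`| A"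
  by (rule fset.map_cong0)

lemma opponent_opponent [simp]: "opponent (opponent p) = p"
  by (cases p) auto

lemma add_game_zero: "0 + G = G" for G :: game
proof (induction "size G" arbitrary: G rule: less_induct)
  case less
  have "(\<lambda>K. 0 + K) |`| options p G = id |`| options p G" for p
    by (rule fimage_cong') (simp add: less size_opts)
  then show ?case by (intro game_eqI) (simp add: options_plus)
qed

lemma add_game_commute: "G + H = H + G" for G H :: game
proof (induction "size G + size H" arbitrary: G H rule: less_induct)
  case less
  have "(\<lambda>K. K + H) |`| options p G = (\<lambda>K. H + K) |`| options p G"
    "(\<lambda>K. G + K) |`| options p H = (\<lambda>K. K + G) |`| options p H" for p
    by (rule fimage_cong', rule less, use size_opts in force)+
  then show ?case by (intro game_eqI) (simp add: options_plus sup_commute)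
qed

lemma add_game_assoc: "(G + H) + K = G + (H + K)" for G H K :: game
proof (induction "size G + size H + size K" arbitrary: G H K rule: less_induct)
  case less
  have "(\<lambda>X. (X + H) + K) |`| options p G = (\<lambda>X. X + (H + K)) |`| options p G"
    "(\<lambda>X. (G + X) + K) |`| options p H = (\<lambda>X. G + (X + K)) |`| options p H"
    "(\<lambda>X. (G + H) + X) |`| options p K = (\<lambda>X. G + (H + X)) |`| options p K" for p
    by (rule fimage_cong', rule less, use size_opts in force)+
  then show ?case
    by (intro game_eqI)
      (simp add: options_plus fimage_funion fset.map_comp comp_def sup_assoc)
qed

instance game :: comm_monoid_add
  by standard (rule add_game_assoc add_game_commute add_game_zero)+

lemma uminus_uminus_game: "- (- G) = G" for G :: game
proof (induction "size G" arbitrary: G rule: less_induct)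
  case less
  have "(\<lambda>K. - (- K)) |`| options p G = id |`| options p G" for p
    by (rule fimage_cong') (simp add: less size_opts)
  then show ?case
    by (intro game_eqI) (simp add: options_uminus fset.map_comp comp_def)
qed

lemma uminus_add_game: "- (G + H) = - G + - H" for G H :: game
proof (induction "size G + size H" arbitrary: G H rule: less_induct)
  case less
  have "(\<lambda>K. - (K + H)) |`| options p G = (\<lambda>K. - K + - H) |`| options p G"
    "(\<lambda>K. - (G + K)) |`| options p H = (\<lambda>K. - G + - K) |`| options p H" for p
    by (rule fimage_cong', rule less, use size_opts in force)+
  then show ?case
    by (intro game_eqI)
      (simp add: options_plus options_uminus fimage_funion fset.map_comp comp_def)
qed

lemma wins_uminus: "wins c p (- G) \<longleftrightarrow> wins c (opponent p) G"
proof (induction "size G" arbitrary: G p rule: less_induct)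
  case less
  have "wins c (opponent p) (- H) \<longleftrightarrow> wins c p H" if "H |\<in>| options (opponent p) G" for H
    using less[OF size_opts[OF that], of "opponent p"] by simp
  then show ?case
    by (subst (1 2) wins.simps) (auto simp: options_uminus)
qed

text \<open>Normal-play equality: interchangeable in every disjunctive sum. The quotient is the group
  of normal-play values of short games.\<close>

definition normal_eq :: "game \<Rightarrow> game \<Rightarrow> bool" where
  "normal_eq G H \<longleftrightarrow> (\<forall>X. outcome Normal (G + X) = outcome Normal (H + X))"

quotient_type game_value = game / normal_eq
  morphisms rep_game_value normal_value
  by (auto intro!: equivpI reflpI sympI transpI simp: normal_eq_def)

lemma outcome_uminus_plus:
  "outcome c (- G + X) \<le> outcome c (- H + X) \<longleftrightarrow> outcome c (H + - X) \<le> outcome c (G + - X)"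
proof -
  have "- K + X = - (K + - X)" for K
    by (simp add: uminus_add_game uminus_uminus_game)
  then show ?thesis
    by (auto simp: outcome_def wins_uminus less_eq_outcome_def)
qed

instantiation game_value :: "{order, zero, uminus}"
begin

lift_definition zero_game_value :: game_value is 0 .

lift_definition uminus_game_value :: "game_value \<Rightarrow> game_value" is uminus
  unfolding normal_eq_def using outcome_uminus_plus by (metis order_antisym order_refl)

lift_definition less_eq_game_value :: "game_value \<Rightarrow> game_value \<Rightarrow> bool"
  is "\<lambda>G H. \<forall>X. outcome Normal (G + X) \<le> outcome Normal (H + X)"
  by (simp add: normal_eq_def)

definition less_game_value :: "game_value \<Rightarrow> game_value \<Rightarrow> bool" where
  "x < y \<longleftrightarrow> x \<le> y \<and> \<not> y \<le> (x :: game_value)"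

instance
proof
  fix x y z :: game_value
  show "x < y \<longleftrightarrow> x \<le> y \<and> \<not> y \<le> x" by (rule less_game_value_def)
  show "x \<le> x" by transfer simp
  show "x \<le> y \<Longrightarrow> y \<le> z \<Longrightarrow> x \<le> z" by transfer (blast intro: order_trans)
  show "x \<le> y \<Longrightarrow> y \<le> x \<Longrightarrow> x = y"
    by transfer (auto simp: normal_eq_def intro: order_antisym)
qed

end


section \<open>Hackenbush\<close>

datatype colour = Blue | Red | Green

text \<open>Finite multigraphs, loops allowed. The fields \<open>ends\<close> and \<open>colour\<close> matter only on
  \<open>edges\<close>.\<close>

record ('v, 'e) hackenbush =
  verts :: "'v fset"
  edges :: "'e fset"
  ends :: "'e \<Rightarrow> 'v uprod"
  colour :: "'e \<Rightarrow> colour"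
  ground :: "'v fset"

definition adjacent :: "('v, 'e) hackenbush \<Rightarrow> 'v \<Rightarrow> 'v \<Rightarrow> bool" where
  "adjacent B u v \<longleftrightarrow> (\<exists>e |\<in>| edges B. ends B e = Upair u v)"

definition grounded :: "('v, 'e) hackenbush \<Rightarrow> 'v \<Rightarrow> bool" where
  "grounded B v \<longleftrightarrow> (\<exists>g |\<in>| ground B. (adjacent B)\<^sup>*\<^sup>* g v)"

definition hackenbush_position :: "('v, 'e) hackenbush \<Rightarrow> bool" where
  "hackenbush_position B \<longleftrightarrow>
     ground B |\<subseteq>| verts B \<and>
     (\<forall>e |\<in>| edges B. set_uprod (ends B e) \<subseteq> fset (verts B)) \<and>
     (\<forall>v |\<in>| verts B. grounded B v)"

definition red_blue :: "('v, 'e) hackenbush \<Rightarrow> bool" where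
  "red_blue B \<longleftrightarrow> (\<forall>e |\<in>| edges B. colour B e \<noteq> Green)"

definition discard_ungrounded :: "('v, 'e) hackenbush \<Rightarrow> ('v, 'e) hackenbush" where
  "discard_ungrounded B = B\<lparr>
     verts := ffilter (grounded B) (verts B),
     edges := ffilter (\<lambda>e. \<forall>v \<in> set_uprod (ends B e). grounded B v) (edges B)\<rparr>"

definition cut :: "('v, 'e) hackenbush \<Rightarrow> 'e \<Rightarrow> ('v, 'e) hackenbush" where
  "cut B e = discard_ungrounded (B\<lparr>edges := edges B |-| {|e|}\<rparr>)"

fun may_cut :: "player \<Rightarrow> colour \<Rightarrow> bool" where
  "may_cut Left c \<longleftrightarrow> c = Blue \<or> c = Green"
| "may_cut Right c \<longleftrightarrow> c = Red \<or> c = Green"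

lemma fcard_edges_cut: "e |\<in>| edges B \<Longrightarrow> fcard (edges (cut B e)) < fcard (edges B)"
  by (rule pfsubset_fcard_mono) (auto simp: cut_def discard_ungrounded_def)

lemma fimage_fcong [fundef_cong]:
  "A = B \<Longrightarrow> (\<And>x. x |\<in>| B \<Longrightarrow> f x = g x) \<Longrightarrow> f |`| A = g |`| B"
  by (simp cong: fset.map_cong)

function game_of :: "('v, 'e) hackenbush \<Rightarrow> game" where
  "game_of B = Game
     ((\<lambda>e. game_of (cut B e)) |`| ffilter (\<lambda>e. may_cut Left (colour B e)) (edges B))
     ((\<lambda>e. game_of (cut B e)) |`| ffilter (\<lambda>e. may_cut Right (colour B e)) (edges B))"
  by pat_completeness auto
termination
  by (relation "Wellfounded.measure (\<lambda>B. fcard (edges B))") (auto intro: fcard_edges_cut)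

declare game_of.simps [simp del]


section \<open>Stalks and Generalized Flowers\<close>

definition stalk :: "nat \<Rightarrow> (nat, nat) hackenbush" where
  "stalk h = \<lparr>
     verts = fset_of_list [0..<Suc h],
     edges = fset_of_list [0..<h],
     ends = (\<lambda>i. Upair i (Suc i)),
     colour = (\<lambda>_. Green),
     ground = {|0|}\<rparr>"

text \<open>All ground vertices of the Blossom are identified with the top vertex \<open>Inl h\<close> of the
  stem.\<close>

definition attach :: "nat \<Rightarrow> ('v, 'e) hackenbush \<Rightarrow> 'v \<Rightarrow> nat + 'v" where
  "attach h B v = (if v |\<in>| ground B then Inl h else Inr v)"

definition flower :: "nat \<Rightarrow> ('v, 'e) hackenbush \<Rightarrow> (nat + 'v, nat + 'e) hackenbush" where
  "flower h B = \<lparr>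
     verts = Inl |`| verts (stalk h) |\<union>| attach h B |`| verts B,
     edges = Inl |`| edges (stalk h) |\<union>| Inr |`| edges B,
     ends = case_sum (\<lambda>i. map_uprod Inl (ends (stalk h) i)) (\<lambda>e. map_uprod (attach h B) (ends B e)),
     colour = case_sum (colour (stalk h)) (colour B),
     ground = Inl |`| ground (stalk h)\<rparr>"

definition blossom_value :: "('v, 'e) hackenbush \<Rightarrow> game_value" where
  "blossom_value B = normal_value (game_of B)"

text \<open>A Generalized Flower is given by the pair of its height and its Blossom.\<close>

type_synonym ('v, 'e) gen_flower = "nat \<times> ('v, 'e) hackenbush"

definition gen_flower :: "('v, 'e) gen_flower \<Rightarrow> bool" where
  "gen_flower = (\<lambda>(h, B). 1 \<le> h \<and> hackenbush_position B \<and> red_blue B)"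

definition blue_flower :: "('v, 'e) gen_flower \<Rightarrow> bool" where
  "blue_flower f \<longleftrightarrow> gen_flower f \<and> blossom_value (snd f) > 0"

definition red_flower :: "('v, 'e) gen_flower \<Rightarrow> bool" where
  "red_flower f \<longleftrightarrow> gen_flower f \<and> blossom_value (snd f) < 0"

definition cancelling :: "('v, 'e) gen_flower \<Rightarrow> ('v, 'e) gen_flower \<Rightarrow> bool" where
  "cancelling f g \<longleftrightarrow> fst f = fst g \<and> blossom_value (snd g) = - blossom_value (snd f)"

text \<open>\<open>gen_flowerbed n bs rs\<close>: the lists \<open>bs\<close> of blue and \<open>rs\<close> of red flowers are admissible for a
  Generalized Flowerbed of size \<open>n\<close>. Any list \<open>ss\<close> of Stalk heights is admissible; a Stalk of
  height 0 is the zero game.\<close>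

definition gen_flowerbed ::
  "nat \<Rightarrow> ('v, 'e) gen_flower list \<Rightarrow> ('v, 'e) gen_flower list \<Rightarrow> bool" where
  "gen_flowerbed n bs rs \<longleftrightarrow>
     length bs = n \<and> (\<forall>f \<in> set bs. blue_flower f) \<and>
     length rs = n \<and> (\<forall>f \<in> set rs. red_flower f)"

definition flowerbed_game ::
  "('v, 'e) gen_flower list \<Rightarrow> ('v, 'e) gen_flower list \<Rightarrow> nat list \<Rightarrow> game" where
  "flowerbed_game bs rs ss =
     (\<Sum>(h, B) \<leftarrow> bs. game_of (flower h B)) +
     (\<Sum>(h, B) \<leftarrow> rs. game_of (flower h B)) +
     (\<Sum>h \<leftarrow> ss. game_of (stalk h))"

text \<open>The player who wins when \<open>p\<close> moves first (\<open>p\<close> or the opponent) can make their next move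
  (the first or the second move of the play) to a position from which they win under both
  conventions. The winner is taken under normal play.\<close>

definition simultaneous_winning_move :: "player \<Rightarrow> game \<Rightarrow> bool" where
  "simultaneous_winning_move p G \<longleftrightarrow>
     (if wins Normal p G
      then \<exists>H |\<in>| options p G. \<forall>c. \<not> wins c (opponent p) H
      else \<forall>H |\<in>| options p G. \<exists>K |\<in>| options (opponent p) H. \<forall>c. \<not> wins c p K)"

end

theory Submission
  imports Defs "HOL-Library.Multiset"
begin

text \<open>By the colon principle, which holds under both conventions because a stem always leaves a
  move, a position is a multiset of components \<open>*\<^sub>h : X\<close> in which only the normal-play value of the
  number \<open>X\<close> matters. Its weight is the number of blue flowers minus the number of red ones, and in
  normal play a player who is ahead by two wins (ahead by one suffices with the move).

  As in Nim, misere play agrees with normal play as long as some stem has height at least 2. If all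
  stems have height at most 1, misere play of \<open>G\<close> is normal play of \<open>G + *\<close>; the two conventions
  are matched at the last tall stem, which can be cut to height 0 or 1 at will.

  A winning move that keeps a tall stem therefore wins under both conventions. If only moves that cut
  the last tall stem win, then exactly one flower is tall. The player of the other colour wins the
  race of cuts by cutting it last, to height 0 or 1 as needed, and when \<open>n \<ge> 2\<close>
  can start by cutting a flower of height 1.\<close>

section \<open>Normal-play order and the colon principle\<close>

text \<open>Blossoms are numbers, so a move inside a blossom never improves its sign for the mover.
  The only way to gain weight is to cut an opposing flower, and such a cut gains exactly one. Weight
  thus measures a race in which a lead of two survives any single move, and in nearly balanced
  positions it forces the move that matters. The delicate point is misere play when all stems have
  height at most 1. The moves of \<open>G\<close> under misere play and of \<open>G + *\<close>
  under normal play correspond, except that in \<open>G + *\<close> the star itself can be taken. So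
  one must show that taking the star is never the only winning move while another move exists. For
  heaps of size 1 this is trivial, since all moves are alike; for flowers it takes a choice of which
  one to cut. Misere play does not respect normal-play values, so everything is done with games as
  forms; values enter only through comparison of blossoms above a nonempty stem.\<close>

lemma wins_Normal:
  "wins Normal p G \<longleftrightarrow> (\<exists>H |\<in>| options p G. \<not> wins Normal (opponent p) H)"
  by (subst wins.simps) simp

text \<open>The relation \<open>G \<ge> 0\<close> seen from \<open>p\<close>. Correspondingly
  \<open>wins Normal p G\<close> says that \<open>G\<close> is greater than or confused with
  0.\<close>

definition nonneg :: "player \<Rightarrow> game \<Rightarrow> bool" where
  "nonneg p G \<longleftrightarrow> \<not> wins Normal (opponent p) G"

lemma nonneg_iff: "nonneg p G \<longleftrightarrow> (\<forall>H |\<in>| options (opponent p) G. wins Normal p H)"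
  unfolding nonneg_def by (subst wins_Normal) auto

lemma wins_Normal_nonneg: "wins Normal p G \<longleftrightarrow> (\<exists>H |\<in>| options p G. nonneg p H)"
  by (simp add: nonneg_def wins_Normal[of p G])

lemma option_plus_left: "G' |\<in>| options p G \<Longrightarrow> G' + H |\<in>| options p (G + H)"
  and option_plus_right: "H' |\<in>| options p H \<Longrightarrow> G + H' |\<in>| options p (G + H)"
  by (simp_all add: options_plus)

text \<open>The two claims feed each other: an opposing move in one component turns
  \<open>nonneg\<close> into \<open>wins\<close> there, and the winning answer in that component
  restores \<open>nonneg\<close>.\<close>

lemma plus_order:
  "(nonneg p G \<longrightarrow> nonneg p H \<longrightarrow> nonneg p (G + H)) \<and>
   (wins Normal p G \<longrightarrow> nonneg p H \<longrightarrow> wins Normal p (G + H))"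
proof (induction "size G + size H" arbitrary: G H rule: less_induct)
  case less
  have "nonneg p (G + H)" if G: "nonneg p G" and H: "nonneg p H"
    unfolding nonneg_iff
  proof
    fix K assume "K |\<in>| options (opponent p) (G + H)"
    then consider (l) G' where "G' |\<in>| options (opponent p) G" "K = G' + H"
      | (r) H' where "H' |\<in>| options (opponent p) H" "K = G + H'"
      by (auto simp: options_plus)
    then show "wins Normal p K"
    proof cases
      case l
      then have "wins Normal p G'" using G by (simp add: nonneg_iff[of p G])
      moreover have "size G' + size H < size G + size H" using size_opts[OF l(1)] by simp
      ultimately show ?thesis using less H l(2) by blast
    next
      case r
      then have "wins Normal p H'" using H by (simp add: nonneg_iff[of p H])
      moreover have "size H' + size G < size G + size H" using size_opts[OF r(1)] by simp
      ultimately have "wins Normal p (H' + G)" using less G by blast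
      then show ?thesis using r by (simp add: add.commute[of G])
    qed
  qed
  moreover have "wins Normal p (G + H)" if G: "wins Normal p G" and H: "nonneg p H"
  proof -
    from G obtain G' where G': "G' |\<in>| options p G" "nonneg p G'"
      by (auto simp: wins_Normal_nonneg)
    then have "nonneg p (G' + H)" using less[of G' H] size_opts[of G'] H by auto
    then show ?thesis using G' by (auto simp: wins_Normal_nonneg[of p "G + H"] options_plus)
  qed
  ultimately show ?case by blast
qed

lemma nonneg_plus: "nonneg p G \<Longrightarrow> nonneg p H \<Longrightarrow> nonneg p (G + H)"
  and wins_plus: "wins Normal p G \<Longrightarrow> nonneg p H \<Longrightarrow> wins Normal p (G + H)"
  using plus_order by blast+

text \<open>The second player copies every move in the other component.\<close>

lemma nonneg_self: "nonneg p (G + - G)"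
proof (induction "size G" arbitrary: G rule: less_induct)
  case less
  show ?case unfolding nonneg_iff
  proof
    fix K assume "K |\<in>| options (opponent p) (G + - G)"
    then consider (l) G' where "G' |\<in>| options (opponent p) G" "K = G' + - G"
      | (r) G' where "G' |\<in>| options p G" "K = G + - G'"
      by (auto simp: options_plus options_uminus)
    then show "wins Normal p K"
    proof cases
      case l
      then have "G' + - G' |\<in>| options p K" by (auto simp: options_plus options_uminus)
      then show ?thesis using less[of G'] size_opts[OF l(1)] by (auto simp: wins_Normal_nonneg[of p K])
    next
      case r
      then have "G' + - G' |\<in>| options p K" by (auto simp: options_plus)
      then show ?thesis using less[of G'] size_opts[OF r(1)] by (auto simp: wins_Normal_nonneg[of p K])
    qed
  qed
qed

lemma wins_plus_zero:
  assumes "\<And>r. nonneg r H"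
  shows "wins Normal p (G + H) \<longleftrightarrow> wins Normal p G"
  using wins_plus[of p G H] nonneg_plus[of "opponent p" G H] assms[of p] assms[of "opponent p"]
  unfolding nonneg_def opponent_opponent by blast

section \<open>Comparison of games from the viewpoint of one player\<close>

text \<open>For \<open>Right\<close> this is the reversed order, so that one proof serves both
  players.\<close>

definition ge_for :: "player \<Rightarrow> game \<Rightarrow> game \<Rightarrow> bool" where
  "ge_for p G H \<longleftrightarrow> nonneg p (G + - H)"

lemma ge_for_refl: "ge_for p G G"
  by (simp add: ge_for_def nonneg_self)

text \<open>The sum \<open>H + (G - H)\<close> plays like \<open>G\<close>, because
  \<open>H - H\<close> is zero.\<close>

lemma ge_for_wins: "ge_for p G H \<Longrightarrow> wins Normal p H \<Longrightarrow> wins Normal p G"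
  using wins_plus[of p H "G + - H"] wins_plus_zero[of "H + - H" p G]
  by (simp add: ge_for_def nonneg_self add_ac)

lemma ge_for_opponent: "ge_for (opponent p) G H \<longleftrightarrow> ge_for p H G"
proof -
  have "G + - H = - (H + - G)" by (simp add: uminus_add_game uminus_uminus_game add.commute)
  then show ?thesis by (simp add: ge_for_def nonneg_def wins_uminus)
qed

lemma ge_for_trans: "ge_for p G H \<Longrightarrow> ge_for p H K \<Longrightarrow> ge_for p G K"
  using nonneg_plus[of p "G + - H" "H + - K"] wins_plus_zero[of "H + - H" "opponent p" "G + - K"]
  by (simp add: ge_for_def nonneg_def nonneg_self[unfolded nonneg_def] add_ac)

lemma uminus_zero_game [simp]: "- (0::game) = 0"
  by (simp add: zero_game_def)

lemma wins_Normal_zero [simp]: "\<not> wins Normal p 0"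
  by (subst wins_Normal) simp

lemma ge_for_zero: "ge_for p G 0 \<longleftrightarrow> \<not> wins Normal (opponent p) G"
  by (simp add: ge_for_def nonneg_def)

text \<open>The answer to a move in \<open>G - H\<close> either reverses that move inside its own
  component or matches it in the other one.\<close>

lemma ge_forE_left:
  assumes "ge_for p G H" "G' |\<in>| options (opponent p) G"
  obtains (left) G'' where "G'' |\<in>| options p G'" "ge_for p G'' H"
  | (right) H' where "H' |\<in>| options (opponent p) H" "ge_for p G' H'"
proof -
  from assms have "wins Normal p (G' + - H)"
    by (auto simp: ge_for_def nonneg_iff[of p "G + - H"] options_plus)
  with that show thesis
    by (auto simp: ge_for_def wins_Normal_nonneg[of p "G' + - H"] options_plus options_uminus)
qed

lemma ge_forE_right:
  assumes "ge_for p G H" "H' |\<in>| options p H"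
  obtains (left) G' where "G' |\<in>| options p G" "ge_for p G' H'"
  | (right) H'' where "H'' |\<in>| options (opponent p) H'" "ge_for p G H''"
proof -
  from assms have "wins Normal p (G + - H')"
    by (auto simp: ge_for_def nonneg_iff[of p "G + - H"] options_plus options_uminus)
  with that show thesis
    by (auto simp: ge_for_def wins_Normal_nonneg[of p "G + - H'"] options_plus options_uminus)
qed

section \<open>Ordinal sums over nim-heaps\<close>

text \<open>The common options of both players in the nim-heap \<open>*h\<close>, namely all smaller
  heaps.\<close>

primrec nimbers :: "nat \<Rightarrow> game fset" where
  "nimbers 0 = {||}"
| "nimbers (Suc h) = finsert (Game (nimbers h) (nimbers h)) (nimbers h)"

text \<open>The ordinal sum \<open>*h : X\<close>: a move in the base discards \<open>X\<close>, a
  move in \<open>X\<close> keeps the base.\<close>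

primrec colon_star :: "nat \<Rightarrow> game \<Rightarrow> game" where
  "colon_star h (Game A B) =
     Game (nimbers h |\<union>| colon_star h |`| A) (nimbers h |\<union>| colon_star h |`| B)"

lemma options_colon_star:
  "options p (colon_star h X) = nimbers h |\<union>| colon_star h |`| options p X"
  by (cases X; cases p) simp_all

lemma colon_star_zero: "colon_star h 0 = Game (nimbers h) (nimbers h)"
  by (simp add: zero_game_def)

lemma in_nimbers: "H |\<in>| nimbers h \<longleftrightarrow> (\<exists>j<h. H = colon_star j 0)"
  by (induction h) (auto simp: colon_star_zero less_Suc_eq)

lemma in_options_colon_star:
  "H |\<in>| options p (colon_star h X) \<longleftrightarrow>
     (\<exists>j<h. H = colon_star j 0) \<or> (\<exists>X' |\<in>| options p X. H = colon_star h X')"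
  by (auto simp: options_colon_star in_nimbers)

lemma wins_optI: "H |\<in>| options p G \<Longrightarrow> \<not> wins c (opponent p) H \<Longrightarrow> wins c p G"
  by (subst wins.simps) auto

text \<open>Stem moves lead to the same position from both sides, moves in \<open>K\<close> are
  copied, and a move in a blossom is either matched in the other blossom or bypassed by reversal.
  Both players' claims are proved together, as each move passes from one to the other.\<close>

lemma colon_principle:
  assumes "0 < h" "ge_for p Y X"
  shows "(wins c p (K + colon_star h X) \<longrightarrow> wins c p (K + colon_star h Y)) \<and>
    (wins c (opponent p) (K + colon_star h Y) \<longrightarrow> wins c (opponent p) (K + colon_star h X))"
  using assms(2)
proof (induction "size K + size X + size Y" arbitrary: K X Y rule: less_induct)
  case less
  let ?q = "opponent p"
  \<comment> \<open>Since the stem can be cut, no player is ever out of moves, and the misere clause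
    for an empty set of options never applies.\<close>
  have stem: "colon_star 0 0 |\<in>| options r (colon_star h Z)" for r Z
    using \<open>0 < h\<close> by (auto simp: in_options_colon_star)
  have winsE: thesis if "wins c r (K + colon_star h Z)"
    "\<And>K'. K' |\<in>| options r K \<Longrightarrow> \<not> wins c (opponent r) (K' + colon_star h Z) \<Longrightarrow> thesis"
    "\<And>j. j < h \<Longrightarrow> \<not> wins c (opponent r) (K + colon_star j 0) \<Longrightarrow> thesis"
    "\<And>Z'. Z' |\<in>| options r Z \<Longrightarrow> \<not> wins c (opponent r) (K + colon_star h Z') \<Longrightarrow> thesis"
    for r Z thesis
  proof -
    have "options r (K + colon_star h Z) \<noteq> {||}"
      using stem[of r Z] by (auto simp: options_plus)
    with that show thesis
      by (subst (asm) wins.simps[of c r "K + colon_star h Z"])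
        (auto simp: options_plus in_options_colon_star)
  qed
  have optK: "K' + colon_star h Z |\<in>| options r (K + colon_star h Z)" if "K' |\<in>| options r K" for K' r Z
    using that by (rule option_plus_left)
  have optj: "K + colon_star j 0 |\<in>| options r (K + colon_star h Z)" if "j < h" for j r Z
    using that by (intro option_plus_right) (auto simp: in_options_colon_star)
  have optZ: "K + colon_star h Z' |\<in>| options r (K + colon_star h Z)" if "Z' |\<in>| options r Z" for Z' r Z
    using that by (intro option_plus_right) (auto simp: in_options_colon_star)
  have "wins c p (K + colon_star h Y)" if w: "wins c p (K + colon_star h X)"
  proof (rule winsE[OF w])
    fix K' assume K': "K' |\<in>| options p K" "\<not> wins c ?q (K' + colon_star h X)"
    then have "\<not> wins c ?q (K' + colon_star h Y)"
      using less.hyps[of K' X Y] less.prems size_opts[OF K'(1)] by auto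
    then show ?thesis using wins_optI[OF optK[OF K'(1)]] by blast
  next
    fix j assume "j < h" "\<not> wins c ?q (K + colon_star j 0)"
    then show ?thesis using wins_optI[OF optj] by blast
  next
    fix X' assume X': "X' |\<in>| options p X" "\<not> wins c ?q (K + colon_star h X')"
    show ?thesis
    proof (rule ge_forE_right[OF less.prems X'(1)])
      fix Y' assume Y': "Y' |\<in>| options p Y" "ge_for p Y' X'"
      then have "\<not> wins c ?q (K + colon_star h Y')"
        using less.hyps[of K X' Y'] X' size_opts[OF X'(1)] size_opts[OF Y'(1)] by auto
      then show ?thesis using wins_optI[OF optZ[OF Y'(1)]] by blast
    next
      \<comment> \<open>The move to \<open>X'\<close> is reversible: the opponent may answer with
        \<open>X''\<close>, so \<open>p\<close> already wins there, and \<open>Y\<close> is at least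
        as good as \<open>X''\<close>.\<close>
      fix X'' assume X'': "X'' |\<in>| options ?q X'" "ge_for p Y X''"
      then have "wins c p (K + colon_star h X'')"
        using X'(2) wins_optI[OF optZ[OF X''(1)], of c] by auto
      then show ?thesis
        using less.hyps[of K X'' Y] X'' size_opts[OF X'(1)] size_opts[OF X''(1)] by auto
    qed
  qed
  moreover have "wins c ?q (K + colon_star h X)" if w: "wins c ?q (K + colon_star h Y)"
  proof (rule winsE[OF w])
    fix K' assume K': "K' |\<in>| options ?q K" "\<not> wins c (opponent ?q) (K' + colon_star h Y)"
    then have "\<not> wins c p (K' + colon_star h X)"
      using less.hyps[of K' X Y] less.prems size_opts[OF K'(1)] by auto
    then show ?thesis using wins_optI[OF optK[OF K'(1)], of c] by simp
  next
    fix j assume "j < h" "\<not> wins c (opponent ?q) (K + colon_star j 0)"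
    then show ?thesis using wins_optI[OF optj] by blast
  next
    fix Y' assume Y': "Y' |\<in>| options ?q Y" "\<not> wins c (opponent ?q) (K + colon_star h Y')"
    show ?thesis
    proof (rule ge_forE_left[OF less.prems Y'(1)])
      fix Y'' assume Y'': "Y'' |\<in>| options p Y'" "ge_for p Y'' X"
      then have "wins c ?q (K + colon_star h Y'')"
        using Y'(2) wins_optI[OF optZ[OF Y''(1)], of c] by auto
      then show ?thesis
        using less.hyps[of K X Y''] Y'' size_opts[OF Y'(1)] size_opts[OF Y''(1)] by auto
    next
      fix X' assume X': "X' |\<in>| options ?q X" "ge_for p Y' X'"
      then have "\<not> wins c p (K + colon_star h X')"
        using less.hyps[of K X' Y'] Y' size_opts[OF X'(1)] size_opts[OF Y'(1)] by auto
      then show ?thesis using wins_optI[OF optZ[OF X'(1)], of c] by simp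
    qed
  qed
  ultimately show ?case by blast
qed

lemma colon_mono:
  assumes "ge_for p Y X" "0 < h"
  shows "wins c p (K + colon_star h X) \<Longrightarrow> wins c p (K + colon_star h Y)"
    and "wins c (opponent p) (K + colon_star h Y) \<Longrightarrow> wins c (opponent p) (K + colon_star h X)"
  using colon_principle assms by blast+

section \<open>Positions and weights\<close>

text \<open>Games all of whose positions are numbers. The weak comparison suffices: moving from
  \<open>X\<close> to \<open>X'\<close> shows that \<open>X'\<close> is never at least
  \<open>X\<close> for the mover, so the inequality is automatically strict.\<close>

inductive numeric :: "game \<Rightarrow> bool" where
  "(\<forall>p. \<forall>X' |\<in>| options p X. numeric X' \<and> ge_for p X X') \<Longrightarrow> numeric X"

lemma numeric_option: "numeric X \<Longrightarrow> X' |\<in>| options p X \<Longrightarrow> numeric X'"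
  and numeric_ge: "numeric X \<Longrightarrow> X' |\<in>| options p X \<Longrightarrow> ge_for p X X'"
  by (auto elim: numeric.cases)

lemma numeric_zero [simp]: "numeric 0"
  by (rule numeric.intros) simp

text \<open>If \<open>Y \<ge> X\<close> fails, the opponent's winning move in \<open>Y - X\<close>
  reaches some \<open>Y' \<le> X\<close> or some \<open>X' \<ge> Y\<close>. A move in a number is to
  the mover's disadvantage, so \<open>Y \<le> Y'\<close> or \<open>X' \<le> X\<close>, and
  \<open>Y \<le> X\<close> follows.\<close>

lemma numeric_total:
  assumes "numeric X" "numeric Y"
  shows "ge_for p X Y \<or> ge_for p Y X"
proof (rule disjCI)
  assume "\<not> ge_for p Y X"
  then have "wins Normal (opponent p) (Y + - X)" by (simp add: ge_for_def nonneg_def)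
  then consider (l) Y' where "Y' |\<in>| options (opponent p) Y" "ge_for (opponent p) Y' X"
    | (r) X' where "X' |\<in>| options p X" "ge_for (opponent p) Y X'"
    by (auto simp: wins_Normal_nonneg[of _ "Y + - X"] options_plus options_uminus ge_for_def)
  then show "ge_for p X Y"
    using numeric_ge[OF assms(1)] numeric_ge[OF assms(2)] ge_for_trans
    by cases (metis ge_for_opponent)+
qed

definition sign :: "player \<Rightarrow> game \<Rightarrow> int" where
  "sign p X = of_bool (wins Normal p X) - of_bool (wins Normal (opponent p) X)"

lemma sign_opponent: "sign (opponent p) X = - sign p X"
  by (simp add: sign_def)

lemma sign_zero [simp]: "sign p 0 = 0"
  by (simp add: sign_def)

lemma numeric_not_both: "numeric X \<Longrightarrow> \<not> (wins Normal p X \<and> wins Normal (opponent p) X)"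
  using numeric_total[of X 0 p] ge_for_opponent[of p X 0]
  by (auto simp: ge_for_zero)

lemma sign_iff:
  assumes "numeric X"
  shows "sign p X = 1 \<longleftrightarrow> wins Normal p X" "sign p X = - 1 \<longleftrightarrow> wins Normal (opponent p) X"
    "0 \<le> sign p X \<longleftrightarrow> ge_for p X 0"
  using numeric_not_both[OF assms, of p] by (auto simp: sign_def ge_for_zero)

lemma sign_range: "- 1 \<le> sign p X" "sign p X \<le> 1"
  by (auto simp: sign_def)

lemma sign_mono: "ge_for p X Y \<Longrightarrow> sign p Y \<le> sign p X"
  using ge_for_wins[of p X Y] ge_for_wins[of "opponent p" Y X] ge_for_opponent[of p Y X]
  by (auto simp: sign_def)

lemma sign_option: "numeric X \<Longrightarrow> X' |\<in>| options p X \<Longrightarrow> sign p X' \<le> sign p X"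
  by (simp add: sign_mono numeric_ge)

lemma sign_option_opponent:
  "numeric X \<Longrightarrow> X' |\<in>| options (opponent p) X \<Longrightarrow> sign p X \<le> sign p X'"
  using sign_option[of X X' "opponent p"] by (simp add: sign_opponent)

section \<open>Multisets of components, their moves and their weight\<close>

text \<open>Pairs of height and blossom; a Stalk has blossom \<open>0\<close>. A component cut at
  the ground remains as \<open>(0, 0)\<close>, of value zero, so that a move always replaces exactly
  one element.\<close>

type_synonym position = "(nat \<times> game) multiset"

definition val :: "position \<Rightarrow> game" where
  "val P = (\<Sum>(h, X) \<in># P. colon_star h X)"

lemma val_empty [simp]: "val {#} = 0"
  and val_add [simp]: "val (add_mset (h, X) P) = colon_star h X + val P"
  by (simp_all add: val_def)

lemma val_union: "val (P + Q) = val P + val Q"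
  by (simp add: val_def)

lemma colon_star_zero_zero [simp]: "colon_star 0 0 = 0"
  by (simp add: zero_game_def)

inductive step :: "player \<Rightarrow> position \<Rightarrow> position \<Rightarrow> bool" for p where
  stem: "j < h \<Longrightarrow> step p (add_mset (h, X) R) (add_mset (j, 0) R)"
| blossom: "X' |\<in>| options p X \<Longrightarrow> step p (add_mset (h, X) R) (add_mset (h, X') R)"

lemma step_add: "step p P P' \<Longrightarrow> step p (add_mset c P) (add_mset c P')"
  by (induction rule: step.induct) (simp_all only: add_mset_commute[of c] step.intros)

lemma step_val: "step p P P' \<Longrightarrow> val P' |\<in>| options p (val P)"
  by (induction rule: step.induct)
    (auto intro!: option_plus_left simp: in_options_colon_star)

lemma options_val: "H |\<in>| options p (val P) \<Longrightarrow> \<exists>P'. step p P P' \<and> H = val P'"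
proof (induction P arbitrary: H)
  case empty
  then show ?case by simp
next
  case (add c P)
  obtain h X where c: "c = (h, X)" by fastforce
  from add.prems consider (l) K where "K |\<in>| options p (colon_star h X)" "H = K + val P"
    | (r) K where "K |\<in>| options p (val P)" "H = colon_star h X + K"
    by (auto simp: c options_plus)
  then show ?case
  proof cases
    case l
    then show ?thesis
      unfolding in_options_colon_star c
      by (metis colon_star_zero_zero val_add step.stem step.blossom)
  next
    case r
    then show ?thesis using add.IH[OF r(1)] step_add[of p P _ c] c by (metis val_add)
  qed
qed

lemma wins_val:
  "wins c p (val P) \<longleftrightarrow>
     (c = Misere \<and> (\<forall>P'. \<not> step p P P')) \<or> (\<exists>P'. step p P P' \<and> \<not> wins c (opponent p) (val P'))"
proof -
  have "options p (val P) = {||} \<longleftrightarrow> (\<forall>P'. \<not> step p P P')"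
    using step_val[of p P] options_val[of _ p P] by blast
  moreover have "(\<exists>H |\<in>| options p (val P). \<not> wins c (opponent p) H) \<longleftrightarrow>
      (\<exists>P'. step p P P' \<and> \<not> wins c (opponent p) (val P'))"
    using step_val[of p P] options_val[of _ p P] by blast
  ultimately show ?thesis by (subst wins.simps) simp
qed

lemma wins_stepI: "step p P P' \<Longrightarrow> \<not> wins c (opponent p) (val P') \<Longrightarrow> wins c p (val P)"
  by (subst wins_val) blast

lemma not_wins_Normal_val:
  "(\<And>P'. step p P P' \<Longrightarrow> wins Normal (opponent p) (val P')) \<Longrightarrow> \<not> wins Normal p (val P)"
  by (subst wins_val) auto

lemma step_size: "step p P P' \<Longrightarrow> size (val P') < size (val P)"
  by (rule size_opts[OF step_val])

definition valid :: "position \<Rightarrow> bool" where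
  "valid P \<longleftrightarrow> (\<forall>(h, X) \<in># P. numeric X \<and> (h = 0 \<longrightarrow> X = 0))"

lemma valid_empty [simp]: "valid {#}"
  and valid_add [simp]: "valid (add_mset (h, X) P) \<longleftrightarrow> numeric X \<and> (h = 0 \<longrightarrow> X = 0) \<and> valid P"
  by (auto simp: valid_def)

lemma valid_step: "step p P P' \<Longrightarrow> valid P \<Longrightarrow> valid P'"
  by (induction rule: step.induct) (auto intro: numeric_option)

definition weight :: "player \<Rightarrow> position \<Rightarrow> int" where
  "weight p P = (\<Sum>(h, X) \<in># P. sign p X)"

lemma weight_empty [simp]: "weight p {#} = 0"
  and weight_add [simp]: "weight p (add_mset (h, X) P) = sign p X + weight p P"
  by (simp_all add: weight_def)

lemma weight_opponent: "weight (opponent p) P = - weight p P"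
  by (induction P) (auto simp: sign_opponent)

text \<open>A cut stem costs \<open>p\<close> at most its own sign, and an opposing move inside a
  number can only raise the sign for \<open>p\<close>.\<close>

lemma weight_step_opponent:
  "step (opponent p) P P' \<Longrightarrow> valid P \<Longrightarrow> weight p P - 1 \<le> weight p P'"
proof (induction rule: step.induct)
  case (stem j h X R)
  then show ?case using sign_range[of p X] by simp
next
  case (blossom X' X h R)
  then show ?case using sign_option_opponent[of X X' p] by simp
qed

lemma weight_posE:
  assumes "1 \<le> weight p P"
  obtains h X R where "P = add_mset (h, X) R" "sign p X = 1"
proof -
  have "\<exists>(h, X) \<in># P. sign p X = 1"
    using assms
  proof (induction P)
    case (add c P)
    obtain h X where c: "c = (h, X)" by fastforce
    show ?case
    proof (cases "sign p X = 1")
      case False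
      then have "sign p X \<le> 0" using sign_range[of p X] by simp
      with add c show ?thesis by auto
    qed (use c in auto)
  qed simp
  then obtain h X where "(h, X) \<in># P" "sign p X = 1" by auto
  with that show thesis by (metis multi_member_split)
qed

lemma height_pos: "valid (add_mset (h, X) R) \<Longrightarrow> sign p X \<noteq> 0 \<Longrightarrow> 0 < h"
  by auto

definition nonnegative :: "player \<Rightarrow> position \<Rightarrow> bool" where
  "nonnegative p P \<longleftrightarrow> (\<forall>(h, X) \<in># P. 0 \<le> sign p X)"

lemma nonnegative_empty [simp]: "nonnegative p {#}"
  and nonnegative_add [simp]:
    "nonnegative p (add_mset (h, X) P) \<longleftrightarrow> 0 \<le> sign p X \<and> nonnegative p P"
  by (auto simp: nonnegative_def)

lemma not_nonnegativeE:
  assumes "\<not> nonnegative p P"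
  obtains h X R where "P = add_mset (h, X) R" "sign p X = - 1"
proof -
  from assms obtain h X where "(h, X) \<in># P" "sign p X < 0" by (force simp: nonnegative_def)
  moreover from this have "sign p X = - 1" using sign_range[of p X] by simp
  ultimately show thesis using that by (metis multi_member_split)
qed

section \<open>Comparison with sums of Stalks\<close>

definition stalks :: "position \<Rightarrow> position" where
  "stalks P = {#(h, 0). (h, X) \<in># P#}"

lemma stalks_empty [simp]: "stalks {#} = {#}"
  and stalks_add [simp]: "stalks (add_mset (h, X) P) = add_mset (h, 0) (stalks P)"
  by (simp_all add: stalks_def)

lemma colon_replace:
  assumes "ge_for p Y X" "h = 0 \<Longrightarrow> X = Y"
  shows "wins c p (K + colon_star h X) \<Longrightarrow> wins c p (K + colon_star h Y)"
    and "wins c (opponent p) (K + colon_star h Y) \<Longrightarrow> wins c (opponent p) (K + colon_star h X)"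
  using colon_mono[of p Y X h c K] assms by (cases "h = 0"; auto)+

lemma replace_stalks:
  assumes "valid P" "nonnegative p P"
  shows "wins c p (K + val (stalks P)) \<Longrightarrow> wins c p (K + val P)"
    and "wins c (opponent p) (K + val P) \<Longrightarrow> wins c (opponent p) (K + val (stalks P))"
  using assms
proof (induction P arbitrary: K)
  case (add a P)
  obtain h X where a: "a = (h, X)" by fastforce
  have ge: "ge_for p X 0" "h = 0 \<Longrightarrow> 0 = X"
    if "valid (add_mset a P)" "nonnegative p (add_mset a P)"
    using that sign_iff(3)[of X p] by (auto simp: a)
  {
    case 1
    then have "wins c p ((K + val (stalks P)) + colon_star h 0)" by (simp add: a add_ac)
    from colon_replace(1)[OF ge[OF 1(2,3)] this]
    have "wins c p ((K + colon_star h X) + val (stalks P))" by (simp add: add_ac)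
    from add.IH(1)[OF this] 1 show ?case by (simp add: a add_ac)
  next
    case 2
    then have "wins c (opponent p) ((K + colon_star h X) + val P)" by (simp add: a add_ac)
    from add.IH(2)[OF this] 2 have "wins c (opponent p) ((K + val (stalks P)) + colon_star h X)"
      by (simp add: a add_ac)
    from colon_replace(2)[OF ge[OF 2(2,3)] this] show ?case by (simp add: a add_ac)
  }
qed simp_all

lemma uminus_nimbers: "uminus |`| nimbers h = nimbers h"
  by (induction h) auto

lemma uminus_val_stalks: "- val (stalks P) = val (stalks P)"
  by (induction P) (auto simp: uminus_add_game colon_star_zero uminus_nimbers)

lemma wins_stalks_opponent: "wins c (opponent p) (val (stalks P)) \<longleftrightarrow> wins c p (val (stalks P))"
  using wins_uminus[of c p "val (stalks P)"] by (simp add: uminus_val_stalks)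

text \<open>Whether a sign vanishes does not depend on the player, so \<open>Left\<close> is an
  arbitrary choice.\<close>

definition null :: "position \<Rightarrow> bool" where
  "null P \<longleftrightarrow> (\<forall>(h, X) \<in># P. sign Left X = 0)"

lemma sign_Left_zero: "sign Left X = 0 \<longleftrightarrow> sign p X = 0"
  using sign_opponent[of Left X] by (cases p) auto

lemma null_nonnegative: "null P \<Longrightarrow> nonnegative p P"
  by (auto simp: null_def nonnegative_def sign_Left_zero[of _ p])

text \<open>All blossoms have value zero, so by the colon principle the position plays like its
  Stalks, which are impartial.\<close>

lemma wins_null_opponent:
  assumes "valid P" "null P"
  shows "wins c (opponent p) (val P) \<longleftrightarrow> wins c p (val P)"
proof -
  have "wins c r (val P) \<longleftrightarrow> wins c r (val (stalks P))" for r
    using replace_stalks[OF assms(1) null_nonnegative[OF assms(2)], of c r 0]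
      replace_stalks[OF assms(1) null_nonnegative[OF assms(2)], of c "opponent r" 0] by auto
  then show ?thesis using wins_stalks_opponent by simp
qed

lemma nonnegative_weight:
  assumes "nonnegative p P"
  shows "0 \<le> weight p P" "weight p P = 0 \<longleftrightarrow> null P"
proof -
  have "0 \<le> weight p P \<and> (weight p P = 0 \<longleftrightarrow> null P)"
    using assms
  proof (induction P)
    case empty
    then show ?case by (simp add: null_def)
  next
    case (add c P)
    then show ?case by (cases c) (auto simp: null_def sign_Left_zero[of _ p])
  qed
  then show "0 \<le> weight p P" "weight p P = 0 \<longleftrightarrow> null P" by auto
qed

text \<open>Flatten all other blossoms. If the resulting sum of stalks is lost for the player to move, \<open>p\<close>
  moves in the blossom to a non-negative value; otherwise the winning move of the sum of stalks
  still wins.\<close>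

lemma nonnegative_wins:
  assumes "valid P" "nonnegative p P" "1 \<le> weight p P"
  shows "wins Normal p (val P)"
proof -
  from assms(3) obtain h X R where P: "P = add_mset (h, X) R" and X: "sign p X = 1"
    by (rule weight_posE)
  let ?K = "val (stalks R)"
  have nX: "numeric X" and h: "0 < h" using assms(1) X unfolding P by auto
  have X0: "ge_for p X 0" using sign_iff(3)[OF nX, of p] X by simp
  have "wins Normal p (?K + colon_star h X)"
  proof (cases "wins Normal p (?K + colon_star h 0)")
    case True
    then show ?thesis using colon_mono(1)[OF X0 h] by blast
  next
    case False
    then have N: "\<not> wins Normal (opponent p) (?K + colon_star h 0)"
      using wins_stalks_opponent[of Normal p "add_mset (h, 0) R"] by (simp add: add_ac)
    from X nX have "wins Normal p X" using sign_iff(1) by blast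
    then obtain X' where X': "X' |\<in>| options p X" "nonneg p X'"
      by (auto simp: wins_Normal_nonneg)
    then have "ge_for p X' 0" by (simp add: ge_for_def)
    then have "\<not> wins Normal (opponent p) (?K + colon_star h X')"
      using colon_mono(2)[OF _ h] N by blast
    moreover have "?K + colon_star h X' |\<in>| options p (?K + colon_star h X)"
      using X'(1) by (intro option_plus_right) (auto simp: in_options_colon_star)
    ultimately show ?thesis by (blast intro: wins_optI)
  qed
  then have "wins Normal p (colon_star h X + val R)"
    using replace_stalks(1)[of R p Normal "colon_star h X"] assms(1,2) by (simp add: P add_ac)
  then show ?thesis by (simp add: P)
qed

text \<open>With the move and a lead of one, \<open>p\<close> cuts an opposing flower to lead by
  two; if there is none, \<open>nonnegative_wins\<close> applies. Against a lead of two, the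
  opponent's move still leaves a lead of one.\<close>

lemma weight_wins:
  assumes "valid P"
  shows "1 \<le> weight p P \<Longrightarrow> wins Normal p (val P)"
    and "2 \<le> weight p P \<Longrightarrow> \<not> wins Normal (opponent p) (val P)"
  using assms
proof (induction "size (val P)" arbitrary: P rule: less_induct)
  case less
  {
    case 1
    show ?case
    proof (cases "nonnegative p P")
      case True
      then show ?thesis using nonnegative_wins 1 by blast
    next
      case False
      then obtain h X R where P: "P = add_mset (h, X) R" and X: "sign p X = - 1"
        by (rule not_nonnegativeE)
      let ?P' = "add_mset (0, 0) R"
      have s: "step p P ?P'" unfolding P
        using 1(2) X by (intro step.stem) (auto simp: P)
      have "\<not> wins Normal (opponent p) (val ?P')"
        using less(2)[OF step_size[OF s]] valid_step[OF s] 1 X by (simp add: P)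
      then show ?thesis using wins_stepI s by blast
    qed
  next
    case 2
    show ?case
    proof (rule not_wins_Normal_val)
      fix P' assume s: "step (opponent p) P P'"
      show "wins Normal (opponent (opponent p)) (val P')"
        using less(1)[OF step_size[OF s]] valid_step[OF s] weight_step_opponent[OF s] 2 by simp
    qed
  }
qed

lemma weight_loses:
  assumes "valid P"
  shows "weight p P \<le> - 1 \<Longrightarrow> wins Normal (opponent p) (val P)"
    and "weight p P \<le> - 2 \<Longrightarrow> \<not> wins Normal p (val P)"
  using weight_wins[OF assms, of "opponent p"] by (auto simp: weight_opponent)

section \<open>Misere play\<close>

definition small :: "position \<Rightarrow> bool" where
  "small P \<longleftrightarrow> (\<forall>(h, X) \<in># P. h \<le> 1)"

lemma small_empty [simp]: "small {#}"
  and small_add [simp]: "small (add_mset (h, X) P) \<longleftrightarrow> h \<le> 1 \<and> small P"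
  by (auto simp: small_def)

lemma step_addE:
  assumes "step p (add_mset (h, X) R) P'"
  obtains (stem) j where "j < h" "P' = add_mset (j, 0) R"
  | (blossom) X' where "X' |\<in>| options p X" "P' = add_mset (h, X') R"
  | (rest) R' where "step p R R'" "P' = add_mset (h, X) R'"
  using assms
proof (cases rule: step.cases)
  case (stem j h' X' S)
  show thesis
  proof (cases "(h', X') = (h, X)")
    case True
    with stem that(1) show thesis by auto
  next
    case False
    with stem(1) obtain T where T: "R = add_mset (h', X') T" "S = add_mset (h, X) T"
      by (auto simp: add_eq_conv_ex)
    have "step p R (add_mset (j, 0) T)" unfolding T using stem by (intro step.stem)
    with that(3) show thesis using stem T by (simp add: add_mset_commute)
  qed
next
  case (blossom X'' X' h' S)
  show thesis
  proof (cases "(h', X') = (h, X)")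
    case True
    with blossom that(2) show thesis by auto
  next
    case False
    with blossom(1) obtain T where T: "R = add_mset (h', X') T" "S = add_mset (h, X) T"
      by (auto simp: add_eq_conv_ex)
    have "step p R (add_mset (h', X'') T)" unfolding T using blossom by (intro step.blossom)
    with that(3) show thesis using blossom T by (simp add: add_mset_commute)
  qed
qed

lemma step_small: "step p P P' \<Longrightarrow> small P \<Longrightarrow> small P'"
  by (induction rule: step.induct) auto

text \<open>Blossom moves keep all heights, so such a move cuts the only tall stem.\<close>

lemma step_to_smallE:
  assumes "step p P P'" "\<not> small P" "small P'"
  obtains h X R j where "P = add_mset (h, X) R" "P' = add_mset (j, 0) R" "2 \<le> h" "j \<le> 1" "small R"
  using assms by (cases rule: step.cases) auto

text \<open>An opposing move inside a blossom never lowers its sign for \<open>p\<close>, which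
  leaves only the cut of a flower of \<open>p\<close>.\<close>

lemma weight_dropE:
  assumes "step (opponent p) P P'" "valid P" "weight p P' < weight p P"
  obtains h X R j where "P = add_mset (h, X) R" "P' = add_mset (j, 0) R" "j < h" "sign p X = 1"
  using assms(1)
proof (cases rule: step.cases)
  case (stem j h X R)
  with assms(3) sign_range[of p X] that show thesis by auto
next
  case (blossom X' X h R)
  with assms(2,3) sign_option_opponent[of X X' p] show thesis by auto
qed

lemma weight_riseE:
  assumes "step p P P'" "valid P" "weight p P < weight p P'"
  obtains h X R j where "P = add_mset (h, X) R" "P' = add_mset (j, 0) R" "j < h" "sign p X = - 1"
  by (rule weight_dropE[of "opponent p" P P'])
    (use assms that in \<open>auto simp: weight_opponent sign_opponent\<close>)

lemma star_star: "\<not> wins Normal p (colon_star h 0 + colon_star h 0)"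
  using nonneg_self[of "opponent p" "colon_star h 0"] uminus_val_stalks[of "{#(h, 0)#}"]
  by (simp add: nonneg_def)

text \<open>The sum is nested to the right because \<open>val_add\<close> unfolds positions to that
  form.\<close>

lemma wins_star_star [simp]:
  "wins Normal p (colon_star h 0 + (colon_star h 0 + G)) \<longleftrightarrow> wins Normal p G"
  using wins_plus_zero[of "colon_star h 0 + colon_star h 0" p G] star_star
  by (simp add: nonneg_def add_ac)

lemma numeric_minimum:
  assumes "finite A" "A \<noteq> {}" "\<And>X. X \<in> A \<Longrightarrow> numeric X"
  shows "\<exists>Y \<in> A. \<forall>Z \<in> A. ge_for p Z Y"
  using assms
proof (induction A rule: finite_ne_induct)
  case (singleton X)
  then show ?case by (simp add: ge_for_refl)
next
  case (insert X A)
  then obtain Y where Y: "Y \<in> A" "\<forall>Z \<in> A. ge_for p Z Y" by auto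
  with insert.prems consider "ge_for p X Y" | "ge_for p Y X" using numeric_total[of X Y p] by auto
  then show ?case
  proof cases
    case 1
    with Y show ?thesis by blast
  next
    case 2
    with Y have "ge_for p Z X" if "Z \<in> A" for Z using ge_for_trans that by blast
    then show ?thesis using ge_for_refl by blast
  qed
qed

lemma small_signE:
  assumes "valid (add_mset (h, X) R)" "small (add_mset (h, X) R)" "sign p X \<noteq> 0"
  shows "h = 1"
  using height_pos[OF assms(1,3)] assms(2) by simp

text \<open>The move is to cut the flower that is worst for \<open>p\<close>: by minimality this is at least as good as the
  cut with which \<open>p\<close> answers the opponent in \<open>P\<close>, and \<open>p\<close> can then remove the additional stalk.\<close>

lemma small_reply_balanced:
  assumes P: "valid P" "small P" "weight p P = 0" "\<not> nonnegative p P"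
    and lose: "\<not> wins Normal (opponent p) (val P)"
  shows "\<exists>P'. step p P P' \<and> \<not> wins Normal (opponent p) (val (add_mset (1, 0) P'))"
proof -
  let ?q = "opponent p"
  let ?A = "{Y \<in> snd ` set_mset P. sign p Y = - 1}"
  have "?A \<noteq> {}" using P(4) by (auto elim!: not_nonnegativeE)
  moreover have "numeric X" if "X \<in> ?A" for X using that P(1) by (auto simp: valid_def)
  ultimately obtain Y where Y: "Y \<in> ?A" and min: "\<And>Z. Z \<in> ?A \<Longrightarrow> ge_for p Z Y"
    using numeric_minimum[of ?A p] by auto
  from Y obtain g where "(g, Y) \<in># P" and sY: "sign p Y = - 1" by auto
  then obtain R where R: "P = add_mset (g, Y) R" by (metis multi_member_split)
  with P(1,2) sY have g: "g = 1" using small_signE[of g Y R p] by simp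
  let ?P' = "add_mset (0, 0) R"
  let ?Q = "add_mset (1, 0) ?P'"
  have s: "step p P ?P'" unfolding R by (rule step.stem) (simp add: g)
  have vQ: "valid ?Q" and wQ: "weight p ?Q = 1" using P sY by (auto simp: R)
  have "\<not> wins Normal ?q (val ?Q)"
  proof (rule not_wins_Normal_val)
    fix Q' assume sQ: "step ?q ?Q Q'"
    have vQ': "valid Q'" using valid_step[OF sQ vQ] .
    show "wins Normal (opponent ?q) (val Q')"
    proof (cases "1 \<le> weight p Q'")
      case True
      then show ?thesis using weight_wins(1)[OF vQ'] by simp
    next
      case False
      with wQ have "weight p Q' < weight p ?Q" by simp
      then obtain h X S j where S: "?Q = add_mset (h, X) S" "Q' = add_mset (j, 0) S" "j < h"
        and X: "sign p X = 1" by (rule weight_dropE[OF sQ vQ])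
      have "(h, X) \<in># ?Q" using S(1) by simp
      then have "(h, X) \<in># R" using X by auto
      then obtain T where T: "R = add_mset (h, X) T" by (metis multi_member_split)
      have h: "h = 1" using small_signE[of h X T p] P(1,2) X by (simp add: R T)
      have "j = 0" using S(3) h by simp
      have "S = {#(0, 0), (1, 0)#} + T" using S(1) T by auto
      then have Q': "val Q' = colon_star 1 0 + val T" using S(2) \<open>j = 0\<close> by simp
      let ?P2 = "add_mset (0, 0) (add_mset (1, Y) T)"
      have P_eq: "P = add_mset (1, X) (add_mset (1, Y) T)" by (simp add: R T g h)
      \<comment> \<open>The hypothesis \<open>lose\<close> is applied to the same cut made in
        \<open>P\<close>. The winning answer of \<open>p\<close> has to raise the weight from -1,
        hence cuts an opposing flower \<open>(1, Z)\<close>.\<close>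
      have "step ?q P ?P2" unfolding P_eq by (rule step.stem) simp
      with lose have "wins Normal p (val ?P2)" using wins_stepI[of ?q P ?P2 Normal] by auto
      then obtain P3 where s3: "step p ?P2 P3" and P3: "\<not> wins Normal ?q (val P3)"
        by (subst (asm) wins_val) auto
      have v2: "valid ?P2" and w2: "weight p ?P2 = - 1" using P X by (auto simp: P_eq)
      have "- 1 < weight p P3"
        using weight_loses(1)[OF valid_step[OF s3 v2]] P3 by force
      then obtain l Z U k where U: "?P2 = add_mset (l, Z) U" "P3 = add_mset (k, 0) U" "k < l"
        and Z: "sign p Z = - 1" using weight_riseE[OF s3 v2] w2 by metis
      have "(l, Z) \<in># ?P2" using U(1) by simp
      then have lZ: "(l, Z) = (1, Y) \<or> (l, Z) \<in># T" using Z by auto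
      then have "(l, Z) \<in># P" by (auto simp: P_eq)
      then have "l \<le> 1" using P(2) by (auto simp: small_def)
      with U(3) have l: "l = 1" "k = 0" by auto
      have "\<not> wins Normal ?q (val T)"
      proof (cases "Z = Y")
        case True
        then have "U = add_mset (0, 0) T" using U(1) by (simp add: l add_mset_commute)
        with P3 U(2) l show ?thesis by simp
      next
        case False
        with lZ have "(1, Z) \<in># T" by (auto simp: l)
        then obtain V where V: "T = add_mset (1, Z) V" by (metis multi_member_split)
        have "U = add_mset (0, 0) (add_mset (1, Y) V)"
          using U(1) by (simp add: l V add_mset_commute)
        then have "\<not> wins Normal ?q (val V + colon_star 1 Y)"
          using P3 U(2) l by (simp add: add.commute)
        moreover have "ge_for p Z Y"
          using \<open>(l, Z) \<in># P\<close> Z by (intro min) force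
        ultimately show ?thesis
          using colon_mono(2)[of p Z Y 1 Normal "val V"] by (auto simp: V add.commute)
      qed
      moreover have "step p (add_mset (1, 0) T) (add_mset (0, 0) T)" by (rule step.stem) simp
      ultimately have "wins Normal p (val (add_mset (1, 0) T))"
        by (intro wins_stepI[of p _ "add_mset (0, 0) T"]) simp_all
      then show ?thesis by (simp add: Q')
    qed
  qed
  with s show ?thesis by blast
qed

text \<open>This is what makes the additional star harmless: if taking the star in
  \<open>P + *\<close> wins and \<open>p\<close> has any move in \<open>P\<close>, then some move
  inside \<open>P\<close> wins as well.\<close>

lemma small_reply:
  assumes P: "valid P" "small P"
    and move: "step p P P0"
    and lose: "\<not> wins Normal (opponent p) (val P)"
  shows "\<exists>P'. step p P P' \<and> \<not> wins Normal (opponent p) (val (add_mset (1, 0) P'))"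
proof (cases "\<exists>X. (1, X) \<in># P \<and> sign p X = 0")
  case True
  then obtain X R where R: "P = add_mset (1, X) R" and X: "sign p X = 0"
    by (metis multi_member_split)
  have "step p P (add_mset (0, 0) R)" unfolding R by (rule step.stem) simp
  \<comment> \<open>The component cut here plays like a star, so the added star merely replaces
    it.\<close>
  moreover have "ge_for (opponent p) X 0"
    using sign_iff(3)[of X "opponent p"] X P by (simp add: R sign_opponent)
  then have "\<not> wins Normal (opponent p) (val R + colon_star 1 0)"
    using colon_mono(1)[of "opponent p" X 0 1 Normal "val R"] lose by (auto simp: R add.commute)
  ultimately show ?thesis
    by (intro exI[of _ "add_mset (0, 0) R"] conjI) (simp_all add: add.commute)
next
  case no_zero: False
  have W: "0 \<le> weight p P" using weight_loses(1)[OF P(1), of p] lose by force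
  show ?thesis
  proof (cases "nonnegative p P")
    case False
    show ?thesis
    proof (cases "weight p P = 0")
      case True
      then show ?thesis using small_reply_balanced P False lose by blast
    next
      case pos: False
      from False obtain h X R where R: "P = add_mset (h, X) R" and X: "sign p X = - 1"
        by (rule not_nonnegativeE)
      have "step p P (add_mset (0, 0) R)" unfolding R
        using P(1) X by (intro step.stem) (auto simp: R)
      moreover have "\<not> wins Normal (opponent p) (val (add_mset (1, 0) (add_mset (0, 0) R)))"
        using P(1) W pos X by (intro weight_wins(2)) (auto simp: R)
      ultimately show ?thesis by blast
    qed
  next
    case True
    \<comment> \<open>Without opposing flowers and without value-zero components of height 1, a part
      of weight 0 consists of exhausted components only.\<close>
    have zeros: "val R = 0" if "set_mset R \<subseteq> set_mset P" "weight p R = 0" for R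
    proof -
      have "nonnegative p R" using True that(1) by (auto simp: nonnegative_def)
      then have "null R" using nonnegative_weight(2) that(2) by blast
      have "(h, X) = (0, 0)" if "(h, X) \<in># R" for h X
      proof -
        have "(h, X) \<in># P" using that \<open>set_mset R \<subseteq> set_mset P\<close> by blast
        moreover have "sign p X = 0" using \<open>null R\<close> that by (auto simp: null_def sign_Left_zero[of _ p])
        ultimately show ?thesis using no_zero P by (fastforce simp: valid_def small_def le_Suc_eq)
      qed
      then have "\<forall>c \<in># R. c = (0, 0)" by auto
      then show ?thesis by (induction R) auto
    qed
    have "weight p P \<noteq> 0"
    proof
      assume "weight p P = 0"
      then have "val P = 0" using zeros by simp
      then show False using step_val[OF move] by simp
    qed
    with W have "1 \<le> weight p P" by simp
    then obtain h X R where R: "P = add_mset (h, X) R" and X: "sign p X = 1"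
      by (rule weight_posE)
    have h: "h = 1" using small_signE[of h X R p] P X by (simp add: R)
    let ?P' = "add_mset (0, 0) R"
    have s: "step r P ?P'" for r unfolding R by (rule step.stem) (simp add: h)
    have "0 \<le> weight p R" using True nonnegative_weight(1)[of p R] by (simp add: R)
    then consider "weight p R = 0" | "weight p R = 1" | "2 \<le> weight p R" by linarith
    then have "\<not> wins Normal (opponent p) (val (add_mset (1, 0) ?P'))"
    proof cases
      \<comment> \<open>The position is a single flower; the opponent could cut it and win, contrary
        to \<open>lose\<close>.\<close>
      case 1
      then have "val ?P' = 0" using zeros[of R] by (auto simp: R)
      then show ?thesis using lose wins_stepI[OF s, of Normal "opponent p"] by simp
    next
      \<comment> \<open>What remains is a star plus a flower of \<open>p\<close> of height 1, which
        is at least as good for \<open>p\<close> as two stars, a zero game.\<close>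
      case 2
      then have "1 \<le> weight p R" by simp
      then obtain g Y T where T: "R = add_mset (g, Y) T" and Y: "sign p Y = 1"
        by (rule weight_posE)
      have g: "g = 1" using small_signE[of g Y T p] P Y by (simp add: R T)
      have "val T = 0" using zeros[of T] 2 Y by (auto simp: R T)
      moreover have "ge_for p Y 0" using sign_iff(3)[of Y p] P Y by (simp add: R T)
      ultimately show ?thesis
        using colon_mono(2)[of p Y 0 1 Normal "colon_star 1 0"] star_star[of "opponent p" 1]
        by (auto simp: T g)
    next
      case 3
      then show ?thesis using P by (intro weight_wins(2)) (auto simp: R)
    qed
    with s show ?thesis by blast
  qed
qed

text \<open>In a valid position any move requires a nonempty stem, and stems are open to both
  players.\<close>

lemma step_other_player:
  assumes "step p P P'" "valid P"
  shows "\<exists>P''. step q P P''"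
  using assms(1)
proof (cases rule: step.cases)
  case (stem j h X R)
  then show ?thesis using step.stem by blast
next
  case (blossom X' X h R)
  then have "X \<noteq> 0" by auto
  then have "0 < h" using assms(2) blossom by auto
  then show ?thesis using step.stem blossom by blast
qed

lemma wins_add_star:
  "j \<le> 1 \<Longrightarrow> wins Normal p (val (add_mset (1, 0) (add_mset (j, 0) R))) \<longleftrightarrow>
    wins Normal p (val (add_mset (1 - j, 0) R))"
  by (cases j) auto

lemma misere_iff_normal:
  assumes "valid P"
  shows "wins Misere p (val P) \<longleftrightarrow> wins Normal p (val (if small P then add_mset (1, 0) P else P))"
  using assms
proof (induction "size (val P)" arbitrary: P p rule: less_induct)
  case less
  let ?q = "opponent p"
  have IH: "wins Misere ?q (val P') \<longleftrightarrow> wins Normal ?q (val (if small P' then add_mset (1, 0) P' else P'))"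
    if "step p P P'" for P'
    using less.hyps[OF step_size[OF that]] valid_step[OF that less.prems] by blast
  show ?case
  proof (cases "small P")
    case True
    have IH': "wins Misere ?q (val P') \<longleftrightarrow> wins Normal ?q (val (add_mset (1, 0) P'))"
      if "step p P P'" for P'
      using IH[OF that] step_small[OF that True] by simp
    show ?thesis
    proof (cases "\<exists>P0. step p P P0")
      case False
      \<comment> \<open>The game is over in \<open>P\<close>: the player to move wins under misere
        play, and in \<open>P + *\<close> wins normal play by taking the star.\<close>
      then have "\<not> step ?q P P'" for P' using step_other_player[OF _ less.prems] by blast
      then have "\<not> wins Normal ?q (val (add_mset (0, 0) P))"
        by (simp, subst wins_val, simp)
      moreover have "step p (add_mset (1, 0) P) (add_mset (0, 0) P)" by (rule step.stem) simp
      ultimately have "wins Normal p (val (add_mset (1, 0) P))"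
        using wins_stepI by blast
      moreover have "wins Misere p (val P)" using False by (subst wins_val) blast
      ultimately show ?thesis using True by simp
    next
      case steps: True
      have "wins Normal p (val (add_mset (1, 0) P)) \<longleftrightarrow>
        (\<exists>P'. step p P P' \<and> \<not> wins Normal ?q (val (add_mset (1, 0) P')))"
      proof
        assume "wins Normal p (val (add_mset (1, 0) P))"
        then obtain P'' where s: "step p (add_mset (1, 0) P) P''" and P'': "\<not> wins Normal ?q (val P'')"
          by (subst (asm) wins_val) auto
        from s show "\<exists>P'. step p P P' \<and> \<not> wins Normal ?q (val (add_mset (1, 0) P'))"
        proof (cases rule: step_addE)
          case (stem j)
          \<comment> \<open>The winning move took the star; \<open>small_reply\<close> supplies one
            inside \<open>P\<close> instead.\<close>
          then have "\<not> wins Normal ?q (val P)" using P'' by simp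
          then show ?thesis using small_reply[OF less.prems True] steps by blast
        next
          case (blossom X')
          then show ?thesis by simp
        next
          case (rest R')
          then show ?thesis using P'' by blast
        qed
      next
        assume "\<exists>P'. step p P P' \<and> \<not> wins Normal ?q (val (add_mset (1, 0) P'))"
        then show "wins Normal p (val (add_mset (1, 0) P))"
          using step_add wins_stepI by blast
      qed
      also have "\<dots> \<longleftrightarrow> wins Misere p (val P)"
        using IH' steps by (subst wins_val[of Misere]) blast
      finally show ?thesis using True by simp
    qed
  next
    case big: False
    \<comment> \<open>The stem may be left at height \<open>1 - j\<close> instead of
      \<open>j\<close>. As \<open>* + * = 0\<close>, adding a star turns either result into the
      other, so misere play after one cut is normal play after the other.\<close>
    have swap: "\<exists>P''. step p P P'' \<and> small P'' \<and>
        (wins Normal ?q (val (add_mset (1, 0) P')) \<longleftrightarrow> wins Normal ?q (val P'')) \<and>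
        (wins Normal ?q (val (add_mset (1, 0) P'')) \<longleftrightarrow> wins Normal ?q (val P'))"
      if s: "step p P P'" and P': "small P'" for P'
    proof -
      obtain h X R j where R: "P = add_mset (h, X) R" "P' = add_mset (j, 0) R" "2 \<le> h" "j \<le> 1" "small R"
        using step_to_smallE[OF s big P'] .
      have "step p P (add_mset (1 - j, 0) R)" unfolding R(1) using R(3) by (intro step.stem) simp
      then show ?thesis
        using R wins_add_star[of j ?q R] wins_add_star[of "1 - j" ?q R]
        by (intro exI[of _ "add_mset (1 - j, 0) R"]) auto
    qed
    have "\<exists>P'. step p P P'"
    proof -
      from big obtain h X where "(h, X) \<in># P" "1 < h" by (auto simp: small_def)
      then show ?thesis using step.stem[of 0 h p X] by (metis multi_member_split less_trans zero_less_one)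
    qed
    then have "wins Misere p (val P) \<longleftrightarrow> (\<exists>P'. step p P P' \<and> \<not> wins Misere ?q (val P'))"
      by (subst wins_val) blast
    also have "\<dots> \<longleftrightarrow> (\<exists>P'. step p P P' \<and> \<not> wins Normal ?q (val P'))"
    proof
      assume "\<exists>P'. step p P P' \<and> \<not> wins Misere ?q (val P')"
      then obtain P' where P': "step p P P'" "\<not> wins Misere ?q (val P')" by blast
      then show "\<exists>P'. step p P P' \<and> \<not> wins Normal ?q (val P')"
        using IH[OF P'(1)] swap[OF P'(1)] by (cases "small P'") auto
    next
      assume "\<exists>P'. step p P P' \<and> \<not> wins Normal ?q (val P')"
      then obtain P' where P': "step p P P'" "\<not> wins Normal ?q (val P')" by blast
      show "\<exists>P'. step p P P' \<and> \<not> wins Misere ?q (val P')"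
      proof (cases "small P'")
        case True
        then obtain P'' where "step p P P''" "small P''" "\<not> wins Normal ?q (val (add_mset (1, 0) P''))"
          using swap[OF P'(1)] P'(2) by blast
        then show ?thesis using IH[of P''] by auto
      next
        case False
        then show ?thesis using IH[OF P'(1)] P' by auto
      qed
    qed
    also have "\<dots> \<longleftrightarrow> wins Normal p (val P)" by (subst wins_val[of Normal]) simp
    finally show ?thesis using big by simp
  qed
qed

section \<open>Moves winning under both conventions\<close>

lemma stalks_null: "null P \<Longrightarrow> valid P \<Longrightarrow> wins c p (K + val P) \<longleftrightarrow> wins c p (K + val (stalks P))"
  using replace_stalks[of P p c K] replace_stalks[of P "opponent p" c K] null_nonnegative by auto

text \<open>Stripped of its blossoms, the position is a sum of stars, worth either 0 or a single
  star.\<close>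

lemma small_null:
  assumes "valid P" "null P" "small P"
  shows "(\<forall>p. \<not> wins Normal p (val P)) \<or> (\<forall>p. \<not> wins Normal p (val (add_mset (1, 0) P)))"
proof -
  have "(\<forall>p. \<not> wins Normal p (val (stalks P))) \<or>
      (\<forall>p. \<not> wins Normal p (val (add_mset (1, 0) (stalks P))))"
    using assms(3)
  proof (induction P)
    case (add c P)
    obtain h X where c: "c = (h, X)" by fastforce
    with add.prems have "h = 0 \<or> h = 1" "small P" by auto
    with add.IH show ?case by (auto simp: c)
  qed simp
  then show ?thesis
    using stalks_null[OF assms(2,1), of Normal _ 0] stalks_null[OF assms(2,1), of Normal _ "colon_star 1 0"]
    by simp
qed

lemma nonnegative_opponentE:
  assumes "\<not> nonnegative (opponent p) P"
  obtains h X R where "P = add_mset (h, X) R" "sign p X = 1"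
  using assms by (rule not_nonnegativeE) (use that in \<open>auto simp: sign_opponent\<close>)

text \<open>The opponent of the owner of the tall flower answers every cut by cutting a flower of height 1;
  at the end only the tall flower can be cut, and its stem can be left at whichever of the heights 0
  and 1 wins.\<close>

lemma one_tall_flower:
  assumes "valid (add_mset (h, X) R)" "2 \<le> h" "sign p X = 1" "small R"
  shows "weight p R = - 1 \<Longrightarrow> wins Normal (opponent p) (val (add_mset (h, X) R))"
    and "weight p R = - 1 \<Longrightarrow> \<not> wins Normal p (val (add_mset (h, X) R))"
    and "weight p R = - 2 \<Longrightarrow> \<not> wins Normal p (val (add_mset (h, X) R))"
    and "weight p R = 0 \<Longrightarrow> wins Normal (opponent p) (val (add_mset (h, X) R))"
  using assms
proof (induction "size (val (add_mset (h, X) R))" arbitrary: X R rule: less_induct)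
  case less
  let ?q = "opponent p" and ?P = "add_mset (h, X) R"
  \<comment> \<open>Besides positions settled by weight, moves link the four claims: claim 1 rests
    on 3, claim 2 on 1 and 4, claim 3 on 1, and claim 4 on 2.\<close>
  note IH = less(1-4)
  have cut: "step r ?P (add_mset (h, X) (add_mset (0, 0) S))"
    if "R = add_mset (g, Y) S" "0 < g" for r g Y S
    unfolding that(1) by (intro step_add step.stem that(2))
  have loses: "wins Normal ?q (val P')" if "step p ?P P'" "weight p P' \<le> - 1" "valid ?P" for P'
    using that valid_step weight_loses(1) by blast
  have leaf: "wins Normal ?q (val ?P)"
    if j: "j \<le> 1" "\<not> wins Normal p (val (add_mset (j, 0) R))" and h: "2 \<le> h" for j
  proof -
    have "step ?q ?P (add_mset (j, 0) R)" using j h by (intro step.stem) simp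
    with j show ?thesis using wins_stepI[of ?q ?P] by simp
  qed
  {
    case 1
    show ?case
    proof (cases "nonnegative ?q R")
      case False
      then obtain g Y S where S: "R = add_mset (g, Y) S" and Y: "sign p Y = 1"
        by (rule nonnegative_opponentE)
      have "0 < g" using 1(2) Y by (auto simp: S)
      then have s: "step ?q ?P (add_mset (h, X) (add_mset (0, 0) S))" using cut S by blast
      have "\<not> wins Normal p (val (add_mset (h, X) (add_mset (0, 0) S)))"
        using 1 Y by (intro IH(3)[OF step_size[OF s]]) (auto simp: S)
      with s show ?thesis using wins_stepI[of ?q ?P] by simp
    next
      case True
      have "1 \<le> weight ?q R" using 1 by (simp add: weight_opponent)
      then obtain g Y Z where Z: "R = add_mset (g, Y) Z" and Y: "sign ?q Y = 1"
        by (rule weight_posE)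
      have wZ: "weight ?q Z = 0" using 1(1) Y by (simp add: Z weight_opponent sign_opponent)
      have nZ: "null Z" using True nonnegative_weight(2)[of ?q Z] wZ by (simp add: Z)
      have vZ: "valid Z" using 1(2) by (simp add: Z)
      have g: "g = 1" using 1(2,5) Y by (auto simp: Z)
      \<comment> \<open>If \<open>?q\<close> loses when moving first in \<open>Z\<close>, then so
        does \<open>p\<close>, and \<open>?q\<close> wins \<open>Z + *\<close> by taking the
        star.\<close>
      have "\<exists>j \<le> 1. wins Normal ?q (val (add_mset (j, 0) Z))"
      proof (cases "wins Normal ?q (val Z)")
        case True
        then show ?thesis by (intro exI[of _ 0]) simp
      next
        case False
        then have "\<not> wins Normal p (val (add_mset (0, 0) Z))"
          using wins_null_opponent[OF vZ nZ] by simp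
        then have "wins Normal ?q (val (add_mset (1, 0) Z))"
          using wins_stepI[OF step.stem[of 0 1 ?q 0 Z], of Normal] by simp
        then show ?thesis by blast
      qed
      then obtain j where j: "j \<le> 1" "wins Normal ?q (val (add_mset (j, 0) Z))" by blast
      \<comment> \<open>At weight -1, \<open>p\<close> has to raise the weight, and the only flower
        to cut is \<open>(1, Y)\<close>. Then \<open>?q\<close> is to move in \<open>Z\<close> with
        a heap of size \<open>j\<close>, as chosen.\<close>
      have "\<not> wins Normal p (val (add_mset (j, 0) R))"
      proof (rule not_wins_Normal_val)
        fix T assume s: "step p (add_mset (j, 0) R) T"
        have v: "valid (add_mset (j, 0) R)" using 1(2) by simp
        show "wins Normal ?q (val T)"
        proof (cases "weight p T \<le> - 1")
          case True
          then show ?thesis using weight_loses(1)[OF valid_step[OF s v]] by blast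
        next
          case False
          then have "weight p (add_mset (j, 0) R) < weight p T" using 1(1) by simp
          then obtain l V S k where S: "add_mset (j, 0) R = add_mset (l, V) S" "T = add_mset (k, 0) S"
              "k < l" and V: "sign p V = - 1"
            by (rule weight_riseE[OF s v])
          have "(l, V) \<in># add_mset (j, 0) (add_mset (1, Y) Z)" using S(1) by (simp add: Z g)
          then have lV: "l = 1" "V = Y"
            using V nZ by (auto simp: null_def sign_Left_zero[of _ p])
          have "S = add_mset (j, 0) Z" using S(1) by (simp add: Z g lV add_mset_commute)
          then show ?thesis using j(2) S(2,3) lV by simp
        qed
      qed
      then show ?thesis using leaf j(1) 1(3) by blast
    qed
  next
    case 2
    show ?case
    proof (rule not_wins_Normal_val)
      fix P' assume s: "step p ?P P'"
      show "wins Normal ?q (val P')"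
        using s
      proof (cases rule: step_addE)
        case (stem j)
        then show ?thesis using loses[OF s] 2 by simp
      next
        case (blossom X')
        have "sign p X' \<le> 1" by (rule sign_range)
        then consider "sign p X' = 1" | "sign p X' \<le> 0" by linarith
        then show ?thesis
        proof cases
          case 1
          show ?thesis using IH(1)[OF step_size[OF s[unfolded blossom]]] 1 2 blossom
            valid_step[OF s] by simp
        next
          case 2
          then show ?thesis using loses[OF s] \<open>weight p R = - 1\<close> \<open>valid ?P\<close> blossom by simp
        qed
      next
        case (rest R')
        have R': "valid P'" "small R'" using valid_step[OF s] step_small[OF rest(1)] 2 by auto
        have "weight ?q R - 1 \<le> weight ?q R'"
          using weight_step_opponent[of ?q R R'] rest(1) 2(2) by simp
        then have "weight p R' \<le> 0" using 2(1) by (simp add: weight_opponent)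
        then consider "weight p R' \<le> - 2" | "weight p R' = - 1" | "weight p R' = 0" by linarith
        then show ?thesis
        proof cases
          case 1
          then show ?thesis using loses[OF s] 2 rest by simp
        next
          case w: 2
          then show ?thesis using IH(1)[OF step_size[OF s[unfolded rest(2)]]] R' 2 rest(2) by blast
        next
          case 3
          then show ?thesis using IH(4)[OF step_size[OF s[unfolded rest(2)]]] R' 2 rest(2) by blast
        qed
      qed
    qed
  next
    case 3
    show ?case
    proof (rule not_wins_Normal_val)
      fix P' assume s: "step p ?P P'"
      show "wins Normal ?q (val P')"
      proof (cases "weight p P' \<le> - 1")
        case True
        then show ?thesis using loses[OF s] 3 by blast
      next
        case False
        then have "weight p ?P < weight p P'" using 3 by simp
        then obtain l V S k where S: "?P = add_mset (l, V) S" "P' = add_mset (k, 0) S"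
            "k < l" and V: "sign p V = - 1"
          by (rule weight_riseE[OF s 3(2)])
        have "(h, X) \<noteq> (l, V)" using V 3(4) by auto
        then obtain T where T: "R = add_mset (l, V) T" "S = add_mset (h, X) T"
          using S(1) by (auto simp: add_eq_conv_ex)
        have "k = 0" using S(3) 3(5) T(1) by simp
        then have P': "P' = add_mset (h, X) (add_mset (0, 0) T)" using S(2) T by (simp add: add_mset_commute)
        have "weight p (add_mset (0, 0) T) = - 1" using 3(1) V T by simp
        then show ?thesis unfolding P'
          using 3 T by (intro IH(1)[OF step_size[OF s[unfolded P']]]) auto
      qed
    qed
  next
    case 4
    show ?case
    proof (cases "nonnegative ?q R")
      case False
      then obtain g Y S where S: "R = add_mset (g, Y) S" and Y: "sign p Y = 1"
        by (rule nonnegative_opponentE)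
      have "0 < g" using 4(2) Y by (auto simp: S)
      then have s: "step ?q ?P (add_mset (h, X) (add_mset (0, 0) S))" using cut S by blast
      have "\<not> wins Normal p (val (add_mset (h, X) (add_mset (0, 0) S)))"
        using 4 Y by (intro IH(2)[OF step_size[OF s]]) (auto simp: S)
      with s show ?thesis using wins_stepI[of ?q ?P] by simp
    next
      case True
      then have "null R" using nonnegative_weight(2)[of ?q R] 4(1) by (simp add: weight_opponent)
      then have "\<exists>j \<le> 1. \<not> wins Normal p (val (add_mset (j, 0) R))"
        using small_null[of R] 4 by (metis add_0 colon_star_zero_zero le_refl val_add valid_add zero_le_one)
      then show ?thesis using leaf 4(3) by blast
    qed
  }
qed

section \<open>Positions lost under both conventions\<close>

definition count_pos :: "player \<Rightarrow> position \<Rightarrow> nat" where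
  "count_pos p P = size {#c \<in># P. sign p (snd c) = 1#}"

lemma count_pos_empty [simp]: "count_pos p {#} = 0"
  and count_pos_add [simp]:
    "count_pos p (add_mset (h, X) P) = of_bool (sign p X = 1) + count_pos p P"
  by (simp_all add: count_pos_def)

lemma count_posE:
  assumes "1 \<le> count_pos p P"
  obtains h X R where "P = add_mset (h, X) R" "sign p X = 1"
proof -
  from assms have "{#c \<in># P. sign p (snd c) = 1#} \<noteq> {#}"
    unfolding count_pos_def by (metis not_one_le_zero size_empty)
  then obtain h X where "(h, X) \<in># P" "sign p X = 1" by auto
  with that show thesis by (metis multi_member_split)
qed

definition wins_both_against :: "player \<Rightarrow> position \<Rightarrow> bool" where
  "wins_both_against p P \<longleftrightarrow> (\<forall>c. \<not> wins c p (val P))"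

lemma wins_both_againstI:
  assumes "valid P" "\<not> small P" "\<not> wins Normal p (val P)"
  shows "wins_both_against p P"
  unfolding wins_both_against_def
proof
  fix c show "\<not> wins c p (val P)"
    using misere_iff_normal[OF assms(1), of p] assms by (cases c) auto
qed

text \<open>The star that represents misere play has sign zero and leaves the weight
  unchanged.\<close>

lemma wins_both_against_weight:
  assumes "valid P" "weight p P \<le> - 2"
  shows "wins_both_against p P"
  unfolding wins_both_against_def
proof
  fix c show "\<not> wins c p (val P)"
    using misere_iff_normal[OF assms(1), of p] weight_loses(2)[OF assms]
      weight_loses(2)[of "add_mset (1, 0) P" p] assms by (cases c) auto
qed

definition tall_flower :: "position \<Rightarrow> bool" where
  "tall_flower P \<longleftrightarrow> (\<exists>(h, X) \<in># P. 2 \<le> h \<and> sign Left X \<noteq> 0)"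

lemma tall_flower_add:
  "tall_flower (add_mset (h, X) P) \<longleftrightarrow> (2 \<le> h \<and> sign p X \<noteq> 0) \<or> tall_flower P"
  by (auto simp: tall_flower_def sign_Left_zero[of X p])

lemma small_not_tall: "small P \<Longrightarrow> \<not> tall_flower P"
  by (force simp: small_def tall_flower_def)

text \<open>If the winning move cuts the last tall stem, that flower is the opponent's, since
  otherwise the opponent would be left ahead and on the move. A second opposing flower can then be
  cut instead: the tall stem survives and \<open>one_tall_flower\<close> decides.\<close>

lemma simultaneous_first:
  assumes P: "valid P" "weight p P = 0" "2 \<le> count_pos (opponent p) P" "tall_flower P"
    and win: "wins Normal p (val P)"
  shows "\<exists>P'. step p P P' \<and> wins_both_against (opponent p) P'"
proof -
  let ?q = "opponent p"
  from win obtain P' where s: "step p P P'" and P': "\<not> wins Normal ?q (val P')"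
    by (subst (asm) wins_val) auto
  show ?thesis
  proof (cases "small P'")
    case False
    then show ?thesis using s P' wins_both_againstI[OF valid_step[OF s P(1)]] by blast
  next
    case True
    have "\<not> small P" using small_not_tall P(4) by blast
    then obtain h X R j where R: "P = add_mset (h, X) R" "P' = add_mset (j, 0) R" "2 \<le> h" "small R"
      using step_to_smallE[OF s _ True] by metis
    have "sign p X \<noteq> 0" using P(4) small_not_tall[OF R(4)] by (simp add: R(1) tall_flower_add[of h X R p])
    moreover have "0 \<le> weight p R"
      using weight_loses(1)[OF valid_step[OF s P(1)], of p] P' by (force simp: R(2))
    ultimately have X: "sign p X = - 1" using P(2) sign_range[of p X] by (simp add: R(1))
    then have "1 \<le> count_pos ?q R" using P(3) by (simp add: R(1) sign_opponent)
    then obtain g Y S where S: "R = add_mset (g, Y) S" and Y: "sign ?q Y = 1" by (rule count_posE)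
    let ?K = "add_mset (h, X) (add_mset (0, 0) S)"
    have "0 < g" using P(1) Y by (auto simp: R(1) S)
    then have sK: "step p P ?K" unfolding R(1) S by (intro step_add step.stem)
    \<comment> \<open>The balance is 0; removing the tall flower and the one just cut, both counted
      +1 for \<open>?q\<close>, gives -2.\<close>
    have "weight ?q (add_mset (0, 0) S) = - 2"
      using P(2) X Y by (simp add: R(1) S weight_opponent sign_opponent)
    then have "\<not> wins Normal ?q (val ?K)"
      using P(1) X R by (intro one_tall_flower(3)) (auto simp: S sign_opponent)
    then show ?thesis
      using sK R(3) wins_both_againstI[OF valid_step[OF sK P(1)]] by auto
  qed
qed

text \<open>The reply depends on the balance after the move of \<open>p\<close>. If \<open>p\<close>
  is behind, cutting a flower of \<open>p\<close> gives a lead of two; if the balance is kept,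
  \<open>simultaneous_first\<close> applies to \<open>H\<close>; otherwise \<open>p\<close> has cut
  an opposing flower, and again only the loss of the last tall stem is a difficulty.\<close>

lemma simultaneous_second:
  assumes P: "valid P" "weight p P = 0" "\<And>r. 2 \<le> count_pos r P" "tall_flower P"
    and lose: "\<not> wins Normal p (val P)" and s: "step p P H"
  shows "\<exists>K. step (opponent p) H K \<and> wins_both_against p K"
proof -
  let ?q = "opponent p"
  have vH: "valid H" using valid_step[OF s P(1)] .
  have win: "wins Normal ?q (val H)" using lose wins_stepI[OF s] by blast
  consider "weight p H \<le> - 1" | "weight p H = 0" | "1 \<le> weight p H" by linarith
  then show ?thesis
  proof cases
    case 1
    have "count_pos p P \<le> count_pos p H + 1" using s by (cases rule: step.cases) auto
    then have "1 \<le> count_pos p H" using P(3)[of p] by simp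
    then obtain h X R where R: "H = add_mset (h, X) R" and X: "sign p X = 1" by (rule count_posE)
    have "0 < h" using vH X by (auto simp: R)
    then have sK: "step ?q H (add_mset (0, 0) R)" unfolding R by (rule step.stem)
    have "wins_both_against p (add_mset (0, 0) R)"
      using 1 X by (intro wins_both_against_weight valid_step[OF sK vH]) (simp add: R)
    with sK show ?thesis by blast
  next
    case 2
    have "2 \<le> count_pos p H \<and> tall_flower H"
      using s
    proof (cases rule: step.cases)
      case (stem j h X R)
      then show ?thesis using 2 P(2,4) P(3)[of p] by (auto simp: tall_flower_add[of _ _ R p])
    next
      case (blossom X' X h R)
      then show ?thesis using 2 P(2,4) P(3)[of p] by (auto simp: tall_flower_add[of _ _ R p])
    qed
    then show ?thesis
      using simultaneous_first[of H ?q] vH 2 win by (simp add: weight_opponent)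
  next
    case 3
    then have "weight p P < weight p H" using P(2) by simp
    then obtain h X R j where R: "P = add_mset (h, X) R" "H = add_mset (j, 0) R" "j < h"
      and X: "sign p X = - 1" by (rule weight_riseE[OF s P(1)])
    have wR: "weight p R = 1" using P(2) X by (simp add: R(1))
    from win obtain K where sK: "step ?q H K" and K: "\<not> wins Normal p (val K)"
      by (subst (asm) wins_val) auto
    show ?thesis
    proof (cases "small K")
      case False
      then show ?thesis using sK K wins_both_againstI[OF valid_step[OF sK vH]] by blast
    next
      case True
      \<comment> \<open>Otherwise \<open>p\<close> has cut the only tall stem, an opposing flower,
        and by \<open>one_tall_flower\<close> would have won \<open>P\<close> with the move.\<close>
      have "\<not> small H"
      proof
        assume "small H"
        then have "small R" by (simp add: R(2))
        then have "2 \<le> h"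
          using P(4) small_not_tall by (auto simp: R(1) tall_flower_add[of h X R p])
        then have "wins Normal (opponent ?q) (val P)"
          unfolding R(1) using P(1) X wR \<open>small R\<close>
          by (intro one_tall_flower(1)) (auto simp: R(1) sign_opponent weight_opponent)
        with lose show False by simp
      qed
      then obtain l Y S k where S: "H = add_mset (l, Y) S" "K = add_mset (k, 0) S" "2 \<le> l" "small S"
        using step_to_smallE[OF sK _ True] by metis
      \<comment> \<open>A winning reply cannot leave \<open>p\<close> ahead and on the move, so the
        tall flower it cuts belongs to \<open>p\<close>.\<close>
      have "weight ?q K > - 1"
        using weight_loses(1)[OF valid_step[OF sK vH], of ?q] K by force
      then have "weight p S \<le> 0" by (simp add: S(2) weight_opponent)
      moreover have wH: "sign p Y + weight p S = 1" using arg_cong[OF S(1), of "weight p"] by (simp add: R(2) wR)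
      ultimately have Y: "sign p Y = 1" "weight p S = 0" using sign_range[of p Y] by auto
      have "of_bool (sign p Y = 1) + count_pos p S = count_pos p R"
        using arg_cong[OF S(1), of "count_pos p"] by (simp add: R(2))
      \<comment> \<open>The two flowers of \<open>p\<close> in \<open>P\<close> survive its own cut,
        so one is left besides the tall one.\<close>
      then have "1 \<le> count_pos p S" using P(3)[of p] X Y by (simp add: R(1))
      then obtain g Z T where T: "S = add_mset (g, Z) T" and Z: "sign p Z = 1" by (rule count_posE)
      let ?K = "add_mset (l, Y) (add_mset (0, 0) T)"
      have "0 < g" using vH Z by (auto simp: S(1) T)
      then have sK': "step ?q H ?K" unfolding S(1) T by (intro step_add step.stem)
      have "\<not> wins Normal p (val ?K)"
        using vH Y Z S(3,4) by (intro one_tall_flower(2)) (auto simp: S(1) T)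
      then show ?thesis using sK' S(3) wins_both_againstI[OF valid_step[OF sK' vH]] by auto
    qed
  qed
qed

lemma outcome_val:
  assumes "valid P" "tall_flower P"
  shows "outcome Normal (val P) = outcome Misere (val P)"
  using misere_iff_normal[OF assms(1)] small_not_tall[of P] assms(2) by (auto simp: outcome_def)

lemma simultaneous_winning_move_val:
  assumes "valid P" "weight p P = 0" "\<And>r. 2 \<le> count_pos r P" "tall_flower P"
  shows "simultaneous_winning_move p (val P)"
proof (cases "wins Normal p (val P)")
  case True
  then show ?thesis
    using simultaneous_first[OF assms(1,2) assms(3) assms(4)] step_val
    by (fastforce simp: simultaneous_winning_move_def wins_both_against_def)
next
  case False
  have "\<exists>K |\<in>| options (opponent p) H. \<forall>c. \<not> wins c p K" if H: "H |\<in>| options p (val P)" for H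
  proof -
    obtain P' where P': "step p P P'" "H = val P'" using options_val[OF H] by blast
    then show ?thesis
      using simultaneous_second[OF assms(1-4) False P'(1)] step_val
      by (fastforce simp: wins_both_against_def)
  qed
  with False show ?thesis by (simp add: simultaneous_winning_move_def)
qed

section \<open>Red-blue Hackenbush positions are numbers\<close>

lemma adjacent_edges: "adjacent (B\<lparr>edges := S\<rparr>) u v \<longleftrightarrow> (\<exists>e |\<in>| S. ends B e = Upair u v)"
  by (simp add: adjacent_def)

lemma grounded_verts [simp]: "grounded (B\<lparr>verts := V, edges := S\<rparr>) = grounded (B\<lparr>edges := S\<rparr>)"
proof -
  have "adjacent (B\<lparr>verts := V, edges := S\<rparr>) = adjacent (B\<lparr>edges := S\<rparr>)"
    by (simp add: adjacent_def fun_eq_iff)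
  then show ?thesis unfolding grounded_def by simp
qed

lemma grounded_ground: "g |\<in>| ground B \<Longrightarrow> grounded B g"
  by (auto simp: grounded_def)

lemma grounded_adjacent: "grounded B u \<Longrightarrow> adjacent B u v \<Longrightarrow> grounded B v"
  by (auto simp: grounded_def intro: rtranclp.rtrancl_into_rtrancl)

lemma grounded_induct [consumes 1, case_names ground adjacent]:
  assumes "grounded B v"
    and "\<And>g. g |\<in>| ground B \<Longrightarrow> P g"
    and "\<And>u v. grounded B u \<Longrightarrow> adjacent B u v \<Longrightarrow> P u \<Longrightarrow> P v"
  shows "P v"
proof -
  from assms(1) obtain g where g: "g |\<in>| ground B" "(adjacent B)\<^sup>*\<^sup>* g v"
    by (auto simp: grounded_def)
  from g(2) have "grounded B v \<and> P v"
  proof induction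
    case base
    then show ?case using g(1) assms(2) grounded_ground by simp
  next
    case (step u v)
    then show ?case using assms(3)[of u v] grounded_adjacent[of B u v] by simp
  qed
  then show ?thesis by simp
qed

lemma grounded_edge:
  assumes "e |\<in>| edges B" "u \<in> set_uprod (ends B e)" "v \<in> set_uprod (ends B e)" "grounded B u"
  shows "grounded B v"
proof (cases "u = v")
  case False
  with assms(2,3) have "ends B e = Upair u v" by (cases "ends B e") auto
  with assms(1) have "adjacent B u v" by (auto simp: adjacent_def)
  with assms(4) show ?thesis by (rule grounded_adjacent)
qed (use assms in simp)

section \<open>Positions of one graph indexed by edge sets\<close>

definition live :: "('v, 'e) hackenbush \<Rightarrow> 'e fset \<Rightarrow> 'e fset" where
  "live B S = ffilter (\<lambda>e. \<forall>v \<in> set_uprod (ends B e). grounded (B\<lparr>edges := S\<rparr>) v) S"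

text \<open>The set \<open>S\<close> may contain edges that have already fallen. Successive cuts
  thus become set differences and commute.\<close>

definition part :: "('v, 'e) hackenbush \<Rightarrow> 'e fset \<Rightarrow> ('v, 'e) hackenbush" where
  "part B S = discard_ungrounded (B\<lparr>edges := S\<rparr>)"

lemma part_eq:
  "part B S = B\<lparr>verts := ffilter (grounded (B\<lparr>edges := S\<rparr>)) (verts B), edges := live B S\<rparr>"
  by (simp add: part_def discard_ungrounded_def live_def)

lemma live_subset: "live B S |\<subseteq>| S"
  by (auto simp: live_def)

lemma liveI:
  "e |\<in>| S \<Longrightarrow> u \<in> set_uprod (ends B e) \<Longrightarrow> grounded (B\<lparr>edges := S\<rparr>) u \<Longrightarrow> e |\<in>| live B S"
  using grounded_edge[of e "B\<lparr>edges := S\<rparr>" u] by (auto simp: live_def)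

lemma grounded_mono:
  assumes "S |\<subseteq>| T" "grounded (B\<lparr>edges := S\<rparr>) v"
  shows "grounded (B\<lparr>edges := T\<rparr>) v"
  using assms(2)
proof (induction rule: grounded_induct)
  case (ground g)
  then show ?case by (intro grounded_ground) simp
next
  case (adjacent u v)
  then have "adjacent (B\<lparr>edges := T\<rparr>) u v" using assms(1) by (auto simp: adjacent_edges)
  with adjacent show ?case by (blast intro: grounded_adjacent)
qed

lemma live_mono: "S |\<subseteq>| T \<Longrightarrow> live B S |\<subseteq>| live B T"
  using grounded_mono[of S T B] by (auto simp: live_def)

text \<open>Paths from the ground use live edges only, so fallen edges may be kept or dropped
  freely.\<close>

lemma grounded_between:
  assumes "live B S |\<subseteq>| T" "T |\<subseteq>| S"
  shows "grounded (B\<lparr>edges := T\<rparr>) = grounded (B\<lparr>edges := S\<rparr>)"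
proof (intro ext iffI)
  fix v assume "grounded (B\<lparr>edges := S\<rparr>) v"
  then show "grounded (B\<lparr>edges := T\<rparr>) v"
  proof (induction rule: grounded_induct)
    case (ground g)
    then show ?case by (intro grounded_ground) simp
  next
    case (adjacent u v)
    then obtain e where e: "e |\<in>| S" "ends B e = Upair u v" by (auto simp: adjacent_edges)
    then have "e |\<in>| live B S" using adjacent by (intro liveI[of _ _ u]) auto
    then have "adjacent (B\<lparr>edges := T\<rparr>) u v" using e(2) assms(1) by (auto simp: adjacent_edges)
    with adjacent show ?case by (blast intro: grounded_adjacent)
  qed
qed (rule grounded_mono[OF assms(2)])

lemma live_between:
  assumes "live B S |\<subseteq>| T" "T |\<subseteq>| S"
  shows "live B T = live B S"
  using assms grounded_between[OF assms] by (auto simp: live_def)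

lemma cut_part: "cut (part B S) e = part B (S |-| {|e|})"
proof -
  let ?T = "live B S |-| {|e|}" and ?S = "S |-| {|e|}"
  have "live B ?S |\<subseteq>| live B S" by (rule live_mono) auto
  then have T: "live B ?S |\<subseteq>| ?T" "?T |\<subseteq>| ?S" using live_subset[of B S] live_subset[of B ?S] by auto
  have "?S |\<subseteq>| S" by auto
  then have "ffilter (grounded (B\<lparr>edges := ?S\<rparr>)) (ffilter (grounded (B\<lparr>edges := S\<rparr>)) (verts B)) =
      ffilter (grounded (B\<lparr>edges := ?S\<rparr>)) (verts B)"
    using grounded_mono[of ?S S B] by auto
  then show ?thesis
    using live_between[OF T] grounded_between[OF T]
    by (simp add: cut_def part_eq discard_ungrounded_def live_def)
qed

lemma part_not_live:
  assumes "e |\<notin>| live B S"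
  shows "part B (S |-| {|e|}) = part B S"
proof -
  have T: "live B S |\<subseteq>| S |-| {|e|}" "S |-| {|e|} |\<subseteq>| S" using assms live_subset[of B S] by auto
  show ?thesis by (simp add: part_eq grounded_between[OF T] live_between[OF T])
qed

lemma part_edges: "hackenbush_position B \<Longrightarrow> part B (edges B) = B"
proof -
  assume B: "hackenbush_position B"
  have "ffilter (grounded B) (verts B) = verts B" using B by (auto simp: hackenbush_position_def)
  moreover have "ffilter (\<lambda>e. \<forall>v \<in> set_uprod (ends B e). grounded B v) (edges B) = edges B"
    using B by (fastforce simp: hackenbush_position_def)
  ultimately show ?thesis by (simp add: part_def discard_ungrounded_def)
qed

lemma options_game_of:
  "options p (game_of B) =
     (\<lambda>e. game_of (cut B e)) |`| ffilter (\<lambda>e. may_cut p (colour B e)) (edges B)"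
  by (cases p) (subst game_of.simps, simp)+

lemma options_part:
  "options p (game_of (part B S)) =
     (\<lambda>e. game_of (part B (S |-| {|e|}))) |`| ffilter (\<lambda>e. may_cut p (colour B e)) (live B S)"
  by (simp add: options_game_of cut_part) (simp add: part_eq)

text \<open>Either a path avoids \<open>e\<close>, or its portion before the first use of
  \<open>e\<close> ends at an endpoint of \<open>e\<close>.\<close>

lemma grounded_remove:
  assumes "grounded (B\<lparr>edges := S\<rparr>) v"
  shows "grounded (B\<lparr>edges := S |-| {|e|}\<rparr>) v \<or>
    (\<exists>u \<in> set_uprod (ends B e). grounded (B\<lparr>edges := S |-| {|e|}\<rparr>) u)"
  using assms
proof (induction rule: grounded_induct)
  case (ground g)
  then have "grounded (B\<lparr>edges := S |-| {|e|}\<rparr>) g" by (intro grounded_ground) simp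
  then show ?case by blast
next
  case (adjacent u v)
  then obtain f where f: "f |\<in>| S" "ends B f = Upair u v" by (auto simp: adjacent_edges)
  show ?case
  proof (cases "f = e")
    case True
    with f adjacent.IH show ?thesis by auto
  next
    case False
    with f have "adjacent (B\<lparr>edges := S |-| {|e|}\<rparr>) u v" by (auto simp: adjacent_edges)
    with adjacent.IH show ?thesis by (blast intro: grounded_adjacent)
  qed
qed

text \<open>Follow a path from the ground until it first meets one of the two edges.\<close>

lemma live_remove:
  assumes "e |\<in>| live B S" "f |\<in>| live B S" "e \<noteq> f"
  shows "f |\<in>| live B (S |-| {|e|}) \<or> e |\<in>| live B (S |-| {|f|})"
proof -
  have S: "e |\<in>| S" "f |\<in>| S" using assms live_subset[of B S] by auto
  obtain v where v: "v \<in> set_uprod (ends B f)" by (cases "ends B f") auto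
  with assms(2) have "grounded (B\<lparr>edges := S\<rparr>) v" by (simp add: live_def)
  with grounded_remove[of S B v f] v obtain u where u: "u \<in> set_uprod (ends B f)"
    "grounded (B\<lparr>edges := S |-| {|f|}\<rparr>) u" by blast
  from grounded_remove[OF u(2), of e] show ?thesis
  proof (elim disjE bexE)
    assume "grounded (B\<lparr>edges := S |-| {|f|} |-| {|e|}\<rparr>) u"
    then have "grounded (B\<lparr>edges := S |-| {|e|}\<rparr>) u" by (rule grounded_mono[rotated]) auto
    then show ?thesis using u(1) S assms(3) by (auto intro: liveI)
  next
    fix w assume "w \<in> set_uprod (ends B e)" "grounded (B\<lparr>edges := S |-| {|f|} |-| {|e|}\<rparr>) w"
    moreover from this(2) have "grounded (B\<lparr>edges := S |-| {|f|}\<rparr>) w" by (rule grounded_mono[rotated]) auto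
    ultimately show ?thesis using S assms(3) by (auto intro: liveI)
  qed
qed

lemma may_cut_opponent: "c \<noteq> Green \<Longrightarrow> may_cut p c \<Longrightarrow> \<not> may_cut (opponent p) c"
  by (cases p) auto

lemma fminus_commute: "S |-| {|e|} |-| {|f|} = S |-| {|f|} |-| {|e|}"
  by auto

lemma fcard_minus_less: "f |\<in>| S \<Longrightarrow> fcard (S |-| {|f|}) < fcard S"
  by (rule pfsubset_fcard_mono) auto

text \<open>In the difference of the two games \<open>p\<close> copies each opposing cut in the
  other component. This fails only for an edge that fell together with \<open>e\<close>.\<close>

lemma ge_for_cut:
  assumes "\<forall>f |\<in>| S. colour B f \<noteq> Green" "may_cut p (colour B e)"
  shows "ge_for p (game_of (part B S)) (game_of (part B (S |-| {|e|})))"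
  using assms(1)
proof (induction "fcard S" arbitrary: S rule: less_induct)
  case less
  let ?q = "opponent p" and ?g = "\<lambda>S. game_of (part B S)"
  show ?case
  proof (cases "e |\<in>| live B S")
    case False
    then show ?thesis by (simp add: part_not_live ge_for_refl)
  next
    case e: True
    have IH: "ge_for p (?g (S |-| {|f|})) (?g (S |-| {|e|} |-| {|f|}))" if "f |\<in>| S" for f
      using less.hyps[OF fcard_minus_less[OF that]] less.prems by (auto simp: fminus_commute[of S e])
    show ?thesis
      unfolding ge_for_def nonneg_iff
    proof
      fix K assume "K |\<in>| options ?q (?g S + - ?g (S |-| {|e|}))"
      then consider
        (left) f where "f |\<in>| live B S" "may_cut ?q (colour B f)"
          "K = ?g (S |-| {|f|}) + - ?g (S |-| {|e|})"
      | (right) f where "f |\<in>| live B (S |-| {|e|})" "may_cut p (colour B f)"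
          "K = ?g S + - ?g (S |-| {|e|} |-| {|f|})"
        by (auto simp: options_plus options_uminus options_part)
      then show "wins Normal p K"
      proof cases
        case left
        have f: "f |\<in>| S" using left(1) live_subset[of B S] by auto
        have "f \<noteq> e" using assms(2) left(2) may_cut_opponent less.prems f by metis
        show ?thesis
        proof (cases "f |\<in>| live B (S |-| {|e|})")
          case True
          then have "?g (S |-| {|e|} |-| {|f|}) |\<in>| options ?q (?g (S |-| {|e|}))"
            using left(2) by (auto simp: options_part)
          then have "?g (S |-| {|f|}) + - ?g (S |-| {|e|} |-| {|f|}) |\<in>| options p K"
            unfolding left(3) by (intro option_plus_right) (auto simp: options_uminus)
          then show ?thesis using IH[OF f] by (auto simp: wins_Normal_nonneg[of p K] ge_for_def)
        next
          case False
          \<comment> \<open>The edge \<open>f\<close> has fallen with \<open>e\<close> and cannot be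
            copied. By \<open>live_remove\<close>, \<open>e\<close> does not fall with
            \<open>f\<close>, and cutting \<open>e\<close> makes the two components equal.\<close>
          then have "e |\<in>| live B (S |-| {|f|})" using live_remove[OF e left(1)] \<open>f \<noteq> e\<close> by blast
          then have "?g (S |-| {|f|} |-| {|e|}) |\<in>| options p (?g (S |-| {|f|}))"
            using assms(2) by (auto simp: options_part)
          then have "?g (S |-| {|f|} |-| {|e|}) + - ?g (S |-| {|e|}) |\<in>| options p K"
            unfolding left(3) by (rule option_plus_left)
          moreover have "?g (S |-| {|f|} |-| {|e|}) = ?g (S |-| {|e|})"
            using part_not_live[OF False] by (simp add: fminus_commute[of S f])
          ultimately show ?thesis using nonneg_self by (auto simp: wins_Normal_nonneg[of p K])
        qed
      next
        case right
        have f: "f |\<in>| live B S" using right(1) live_mono[of "S |-| {|e|}" S B] by auto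
        then have "?g (S |-| {|f|}) |\<in>| options p (?g S)" using right(2) by (auto simp: options_part)
        then have "?g (S |-| {|f|}) + - ?g (S |-| {|e|} |-| {|f|}) |\<in>| options p K"
          unfolding right(3) by (rule option_plus_left)
        moreover have "f |\<in>| S" using f live_subset[of B S] by auto
        ultimately show ?thesis using IH[of f] by (auto simp: wins_Normal_nonneg[of p K] ge_for_def)
      qed
    qed
  qed
qed

lemma numeric_part:
  assumes "\<forall>f |\<in>| S. colour B f \<noteq> Green"
  shows "numeric (game_of (part B S))"
  using assms
proof (induction "fcard S" arbitrary: S rule: less_induct)
  case less
  show ?case
  proof (rule numeric.intros, intro allI ballI)
    fix p X' assume "X' |\<in>| options p (game_of (part B S))"
    then obtain e where e: "e |\<in>| live B S" "may_cut p (colour B e)"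
      and X': "X' = game_of (part B (S |-| {|e|}))"
      by (auto simp: options_part)
    have "e |\<in>| S" using e(1) live_subset[of B S] by auto
    then have "numeric X'" using less.hyps[OF fcard_minus_less] less.prems by (simp add: X')
    then show "numeric X' \<and> ge_for p (game_of (part B S)) X'"
      using ge_for_cut[OF less.prems e(2)] by (simp add: X')
  qed
qed

lemma numeric_game_of: "hackenbush_position B \<Longrightarrow> red_blue B \<Longrightarrow> numeric (game_of B)"
  using numeric_part[of "edges B" B] by (simp add: part_edges red_blue_def)

section \<open>Stalks and flowers as ordinal sums\<close>

text \<open>Serves Stalks, with \<open>X\<close> empty, and Flowers, with \<open>X\<close> the
  Blossom. Edges of \<open>X\<close> may touch the path only at its top \<open>a n\<close>, which
  falls with every cut \<open>j < n\<close>.\<close>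

lemma edges_cut_stem:
  fixes a :: "nat \<Rightarrow> 'v" and f :: "nat \<Rightarrow> 'e" and G :: "('v, 'e) hackenbush"
  assumes edges: "edges G = f |`| fset_of_list [0..<n] |\<union>| X"
    and ground: "ground G = {|a 0|}"
    and ends: "\<And>i. i < n \<Longrightarrow> ends G (f i) = Upair (a i) (a (Suc i))"
    and inj: "inj a"
    and X: "\<And>e i. e |\<in>| X \<Longrightarrow> i < n \<Longrightarrow> a i \<notin> set_uprod (ends G e)"
    and j: "j < n"
  shows "edges (cut G (f j)) = f |`| fset_of_list [0..<j]"
proof -
  let ?G = "G\<lparr>edges := edges G |-| {|f j|}\<rparr>"
  have neq: "f i \<noteq> f j" if "i < n" "i \<noteq> j" for i
    using ends[of i] ends[of j] that j inj by (auto simp: inj_eq)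
  have edgesD: "(\<exists>i<n. i \<noteq> j \<and> e = f i) \<or> e |\<in>| X" if "e |\<in>| edges ?G" for e
    using that by (auto simp: edges fset_of_list_elem)
  have up: "grounded ?G (a k)" if "k \<le> j" for k
    using that
  proof (induction k)
    case 0
    then show ?case by (intro grounded_ground) (simp add: ground)
  next
    case (Suc k)
    then have "f k |\<in>| edges ?G" using neq[of k] j by (auto simp: edges fset_of_list_elem)
    then have "adjacent ?G (a k) (a (Suc k))" using ends[of k] Suc j by (force simp: adjacent_def)
    with Suc show ?case by (auto intro: grounded_adjacent)
  qed
  have down: "\<exists>k\<le>j. v = a k" if "grounded ?G v" for v
    using that
  proof (induction rule: grounded_induct)
    case (ground g)
    then show ?case using assms(2) by auto
  next
    case (adjacent u v)
    then obtain k e where k: "k \<le> j" "u = a k" and e: "e |\<in>| edges ?G" "ends G e = Upair u v"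
      by (auto simp: adjacent_def)
    from edgesD[OF e(1)] show ?case
    proof
      assume "\<exists>i<n. i \<noteq> j \<and> e = f i"
      then obtain i where i: "i < n" "i \<noteq> j" "e = f i" by blast
      with ends[of i] e(2) k inj have "(i = k \<and> v = a (Suc i)) \<or> (Suc i = k \<and> v = a i)"
        by (auto simp: inj_eq)
      with k i show ?thesis by (metis Suc_leI Suc_leD le_neq_implies_less)
    next
      assume "e |\<in>| X"
      then show ?thesis using X[of e k] k j e(2) by auto
    qed
  qed
  have "e |\<in>| edges (cut G (f j)) \<longleftrightarrow> e |\<in>| f |`| fset_of_list [0..<j]" for e
  proof
    assume "e |\<in>| edges (cut G (f j))"
    then have e: "e |\<in>| edges ?G" "\<And>v. v \<in> set_uprod (ends G e) \<Longrightarrow> grounded ?G v"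
      by (auto simp: cut_def discard_ungrounded_def)
    from edgesD[OF e(1)] show "e |\<in>| f |`| fset_of_list [0..<j]"
    proof
      assume "\<exists>i<n. i \<noteq> j \<and> e = f i"
      then obtain i where i: "i < n" "i \<noteq> j" "e = f i" by blast
      then have "grounded ?G (a (Suc i))" using ends e(2) by simp
      then have "i < j" using down inj by (force simp: inj_eq)
      with i show ?thesis by (auto simp: fset_of_list_elem)
    next
      assume "e |\<in>| X"
      obtain v where v: "v \<in> set_uprod (ends G e)" by (cases "ends G e") auto
      then obtain k where "k \<le> j" "v = a k" using e(2) down by blast
      then show ?thesis using X[OF \<open>e |\<in>| X\<close>, of k] v j by simp
    qed
  next
    assume "e |\<in>| f |`| fset_of_list [0..<j]"
    then obtain i where i: "i < j" "e = f i" by (auto simp: fset_of_list_elem)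
    then have "e |\<in>| edges ?G" using neq[of i] j by (auto simp: edges fset_of_list_elem)
    moreover have "grounded ?G (a i)" "grounded ?G (a (Suc i))" using up i by auto
    ultimately show "e |\<in>| edges (cut G (f j))"
      using i ends[of i] j by (simp add: cut_def discard_ungrounded_def)
  qed
  then show ?thesis by blast
qed

lemma ground_cut [simp]: "ground (cut G e) = ground G"
  and ends_cut [simp]: "ends (cut G e) = ends G"
  and colour_cut [simp]: "colour (cut G e) = colour G"
  by (simp_all add: cut_def discard_ungrounded_def)

lemma may_cut_Green [simp]: "may_cut p Green"
  by (cases p) auto

lemma game_of_path:
  fixes a :: "nat \<Rightarrow> 'v" and f :: "nat \<Rightarrow> 'e" and G :: "('v, 'e) hackenbush"
  assumes "edges G = f |`| fset_of_list [0..<n]"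
    and "ground G = {|a 0|}"
    and "\<And>i. i < n \<Longrightarrow> ends G (f i) = Upair (a i) (a (Suc i))"
    and "\<And>i. i < n \<Longrightarrow> colour G (f i) = Green"
    and "inj a"
  shows "game_of G = colon_star n 0"
  using assms(1-4)
proof (induction n arbitrary: G rule: less_induct)
  case (less n)
  have "game_of (cut G (f j)) = colon_star j 0" if "j < n" for j
  proof (rule less.IH[OF that])
    show "edges (cut G (f j)) = f |`| fset_of_list [0..<j]"
      using less.prems assms(5) that by (intro edges_cut_stem[of G f n "{||}" a]) auto
  qed (use less.prems that in auto)
  moreover have "ffilter (\<lambda>e. may_cut p (colour G e)) (edges G) = f |`| fset_of_list [0..<n]" for p
    using less.prems(4) by (auto simp: less.prems(1) fset_of_list_elem)
  ultimately have "H |\<in>| options p (game_of G) \<longleftrightarrow> H |\<in>| options p (colon_star n 0)" for p H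
    by (auto simp: options_game_of in_options_colon_star fset_of_list_elem image_iff)
  then show ?case by (intro game_eqI) blast
qed

lemma game_of_stalk: "game_of (stalk h) = colon_star h 0"
  by (rule game_of_path[of _ id _ id]) (auto simp: stalk_def)

lemma attach_edges [simp]: "attach h (B\<lparr>edges := S\<rparr>) = attach h B"
  by (simp add: attach_def fun_eq_iff)

lemma grounded_flower:
  "grounded (flower h B) w \<longleftrightarrow> (\<exists>k\<le>h. w = Inl k) \<or> (\<exists>v. grounded B v \<and> w = attach h B v)"
proof
  assume "grounded (flower h B) w"
  then show "(\<exists>k\<le>h. w = Inl k) \<or> (\<exists>v. grounded B v \<and> w = attach h B v)"
  proof (induction rule: grounded_induct)
    case (ground g)
    then show ?case by (auto simp: flower_def stalk_def)
  next
    case (adjacent u w)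
    then obtain e where e: "e |\<in>| edges (flower h B)" "ends (flower h B) e = Upair u w"
      by (auto simp: adjacent_def)
    show ?case
    proof (cases e)
      case (Inl i)
      with e show ?thesis by (auto simp: flower_def stalk_def fset_of_list_elem)
    next
      case (Inr e')
      obtain x y where xy: "ends B e' = Upair x y" by (cases "ends B e'") auto
      have e': "e' |\<in>| edges B" using e(1) Inr by (auto simp: flower_def)
      have uw: "Upair (attach h B x) (attach h B y) = Upair u w"
        using e(2) Inr xy by (simp add: flower_def)
      \<comment> \<open>Only ground vertices of the Blossom are mapped into the stem, so
        identification of vertices cannot ground anything new.\<close>
      have top: "grounded B v" if "attach h B v = Inl k" for v k
        using that by (auto simp: attach_def grounded_ground split: if_splits)
      have "grounded B v" if "u = attach h B v" for v
      proof -
        from adjacent.IH show ?thesis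
        proof (elim disjE exE conjE)
          fix v' assume "grounded B v'" "u = attach h B v'"
          with that show ?thesis by (auto simp: attach_def grounded_ground split: if_splits)
        qed (use that top in auto)
      qed
      moreover have "adjacent B x y" "adjacent B y x" using e' xy by (auto simp: adjacent_def intro!: bexI[of _ e'])
      ultimately show ?thesis using uw by (auto intro: grounded_adjacent)
    qed
  qed
next
  have stem: "grounded (flower h B) (Inl k)" if "k \<le> h" for k
    using that
  proof (induction k)
    case 0
    then show ?case by (intro grounded_ground) (simp add: flower_def stalk_def)
  next
    case (Suc k)
    then have "adjacent (flower h B) (Inl k) (Inl (Suc k))"
      by (auto simp: adjacent_def flower_def stalk_def fset_of_list_elem intro!: bexI[of _ "Inl k"])
    with Suc show ?case by (auto intro: grounded_adjacent)
  qed
  have "grounded (flower h B) (attach h B v)" if "grounded B v" for v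
    using that
  proof (induction rule: grounded_induct)
    case (ground g)
    then show ?case using stem by (simp add: attach_def)
  next
    case (adjacent u v)
    then obtain e where "e |\<in>| edges B" "ends B e = Upair u v" by (auto simp: adjacent_def)
    then have "adjacent (flower h B) (attach h B u) (attach h B v)"
      by (auto simp: adjacent_def flower_def intro!: bexI[of _ "Inr e"])
    with adjacent show ?case by (blast intro: grounded_adjacent)
  qed
  with stem show "(\<exists>k\<le>h. w = Inl k) \<or> (\<exists>v. grounded B v \<and> w = attach h B v) \<Longrightarrow>
    grounded (flower h B) w" by auto
qed

lemma grounded_flower_attach: "grounded (flower h B) (attach h B v) \<longleftrightarrow> grounded B v"
  by (auto simp: grounded_flower attach_def grounded_ground split: if_splits)

lemma grounded_flower_Inl: "k \<le> h \<Longrightarrow> grounded (flower h B) (Inl k)"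
  by (auto simp: grounded_flower)

lemma discard_flower: "discard_ungrounded (flower h B) = flower h (discard_ungrounded B)"
proof -
  let ?D = "discard_ungrounded B"
  have att: "attach h ?D = attach h B"
    by (simp add: attach_def discard_ungrounded_def fun_eq_iff)
  have "ffilter (grounded (flower h B)) (verts (flower h B)) =
      Inl |`| verts (stalk h) |\<union>| attach h B |`| verts ?D"
    by (rule fset_eqI)
      (auto simp: flower_def[of h B, THEN arg_cong[where f = verts]] grounded_flower_attach
        grounded_flower_Inl stalk_def fset_of_list_elem discard_ungrounded_def)
  moreover have "ffilter (\<lambda>e. \<forall>v \<in> set_uprod (ends (flower h B) e). grounded (flower h B) v)
      (edges (flower h B)) = Inl |`| edges (stalk h) |\<union>| Inr |`| edges ?D"
    by (rule fset_eqI)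
      (auto simp: flower_def[of h B, THEN arg_cong[where f = edges]]
        flower_def[of h B, THEN arg_cong[where f = ends]] grounded_flower_attach
        grounded_flower_Inl stalk_def fset_of_list_elem discard_ungrounded_def uprod.set_map)
  ultimately show ?thesis
    unfolding discard_ungrounded_def[of "flower h B"]
    by (simp add: flower_def att) (simp add: discard_ungrounded_def)
qed

lemma flower_cut_blossom: "cut (flower h B) (Inr e) = flower h (cut B e)"
proof -
  have "(flower h B)\<lparr>edges := edges (flower h B) |-| {|Inr e|}\<rparr> = flower h (B\<lparr>edges := edges B |-| {|e|}\<rparr>)"
    by (auto simp: flower_def)
  then show ?thesis by (simp add: cut_def discard_flower)
qed

lemma flower_cut_stem:
  assumes "i < h"
  shows "game_of (cut (flower h B) (Inl i)) = colon_star i 0"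
proof (rule game_of_path)
  show "edges (cut (flower h B) (Inl i)) = Inl |`| fset_of_list [0..<i]"
  proof (rule edges_cut_stem)
    show "edges (flower h B) = Inl |`| fset_of_list [0..<h] |\<union>| Inr |`| edges B"
      by (simp add: flower_def stalk_def)
    show "Inl k \<notin> set_uprod (ends (flower h B) e)" if "e |\<in>| Inr |`| edges B" "k < h" for e k
      using that by (auto simp: flower_def uprod.set_map attach_def split: if_splits)
  qed (use assms in \<open>auto simp: flower_def stalk_def\<close>)
qed (use assms in \<open>auto simp: flower_def stalk_def\<close>)

text \<open>A stem cut drops the whole Blossom and a Blossom cut keeps the stem, exactly as in an
  ordinal sum.\<close>

lemma game_of_flower: "game_of (flower h B) = colon_star h (game_of B)"
proof (induction "fcard (edges B)" arbitrary: B rule: less_induct)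
  case less
  have IH: "game_of (cut (flower h B) (Inr e)) = colon_star h (game_of (cut B e))" if "e |\<in>| edges B" for e
    using less[OF fcard_edges_cut[OF that]] by (simp add: flower_cut_blossom)
  have "ffilter (\<lambda>e. may_cut p (colour (flower h B) e)) (edges (flower h B)) =
      Inl |`| fset_of_list [0..<h] |\<union>| Inr |`| ffilter (\<lambda>e. may_cut p (colour B e)) (edges B)" for p
    by (auto simp: flower_def stalk_def)
  then have "H |\<in>| options p (game_of (flower h B)) \<longleftrightarrow> H |\<in>| options p (colon_star h (game_of B))" for p H
    using IH flower_cut_stem[of _ h B]
    by (auto simp: options_game_of in_options_colon_star fset_of_list_elem image_iff bex_Un)
  then show ?case by (intro game_eqI) blast
qed

section \<open>Flowerbeds\<close>

lemma ge_for_plus: "ge_for p Y X \<Longrightarrow> ge_for p (Y + Z) (X + Z)"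
  using wins_plus_zero[of "Z + - Z" "opponent p" "Y + - X"]
  by (simp add: ge_for_def nonneg_def nonneg_self[unfolded nonneg_def] uminus_add_game add_ac)

text \<open>Adding a common game preserves the comparison, so outcomes are ordered in every context,
  as the order on values demands.\<close>

lemma normal_value_le: "ge_for Left Y X \<Longrightarrow> normal_value X \<le> normal_value Y"
proof -
  assume "ge_for Left Y X"
  then have "ge_for Left (Y + Z) (X + Z)" "ge_for Right (X + Z) (Y + Z)" for Z
    using ge_for_plus[of Left Y X Z] ge_for_opponent[of Left "X + Z" "Y + Z"] by simp_all
  then have "outcome Normal (X + Z) \<le> outcome Normal (Y + Z)" for Z
    using ge_for_wins[of Left "Y + Z" "X + Z"] ge_for_wins[of Right "X + Z" "Y + Z"]
    by (simp add: outcome_def less_eq_outcome_def)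
  then show ?thesis by (simp add: less_eq_game_value.abs_eq)
qed

lemma normal_value_le_zeroD: "normal_value X \<le> 0 \<Longrightarrow> \<not> wins Normal Left X"
  and zero_le_normal_valueD: "0 \<le> normal_value X \<Longrightarrow> \<not> wins Normal Right X"
proof -
  assume "normal_value X \<le> 0"
  then have "outcome Normal (X + 0) \<le> outcome Normal (0 + 0)"
    unfolding zero_game_value_def less_eq_game_value.abs_eq by blast
  then show "\<not> wins Normal Left X"
    by (auto simp: outcome_def less_eq_outcome_def split: if_splits)
next
  assume "0 \<le> normal_value X"
  then have "outcome Normal (0 + 0) \<le> outcome Normal (X + 0)"
    unfolding zero_game_value_def less_eq_game_value.abs_eq by blast
  then show "\<not> wins Normal Right X"
    by (auto simp: outcome_def less_eq_outcome_def split: if_splits)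
qed

lemma sign_blue:
  assumes "0 < normal_value X"
  shows "sign Left X = 1"
proof -
  have "\<not> wins Normal Right X" using assms zero_le_normal_valueD by (simp add: less_game_value_def)
  moreover have "\<not> ge_for Left 0 X"
    using assms normal_value_le[of 0 X] by (auto simp: less_game_value_def zero_game_value_def)
  then have "wins Normal Left X"
    using ge_for_opponent[of Left X 0] ge_for_zero[of Right X] by simp
  ultimately show ?thesis by (simp add: sign_def)
qed

lemma sign_red:
  assumes "normal_value X < 0"
  shows "sign Left X = - 1"
proof -
  have "\<not> wins Normal Left X" using assms normal_value_le_zeroD by (simp add: less_game_value_def)
  moreover have "\<not> ge_for Left X 0"
    using assms normal_value_le[of X 0] by (auto simp: less_game_value_def zero_game_value_def)
  then have "wins Normal Right X" by (simp add: ge_for_zero)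
  ultimately show ?thesis by (simp add: sign_def)
qed

definition flower_position :: "('v, 'e) gen_flower list \<Rightarrow> position" where
  "flower_position fs = mset (map (\<lambda>(h, B). (h, game_of B)) fs)"

definition stalk_position :: "nat list \<Rightarrow> position" where
  "stalk_position ss = mset (map (\<lambda>h. (h, 0)) ss)"

lemma val_flower_position: "val (flower_position fs) = (\<Sum>(h, B) \<leftarrow> fs. game_of (flower h B))"
  by (induction fs) (auto simp: flower_position_def game_of_flower)

lemma val_stalk_position: "val (stalk_position ss) = (\<Sum>h \<leftarrow> ss. game_of (stalk h))"
  by (induction ss) (auto simp: stalk_position_def game_of_stalk)

lemma stalk_position_simps:
  "valid (stalk_position ss)" "weight p (stalk_position ss) = 0" "count_pos p (stalk_position ss) = 0"
  by (induction ss) (auto simp: stalk_position_def)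

lemma flower_position_simps:
  assumes "\<And>f. f \<in> set fs \<Longrightarrow> gen_flower f \<and> sign p (game_of (snd f)) = s"
  shows "valid (flower_position fs)" "weight p (flower_position fs) = s * int (length fs)"
    "count_pos p (flower_position fs) = (if s = 1 then length fs else 0)"
proof -
  have "valid (flower_position fs) \<and> weight p (flower_position fs) = s * int (length fs) \<and>
      count_pos p (flower_position fs) = (if s = 1 then length fs else 0)"
    using assms
  proof (induction fs)
    case (Cons f fs)
    obtain h B where f: "f = (h, B)" by fastforce
    have "numeric (game_of B) \<and> 0 < h \<and> sign p (game_of B) = s"
      using Cons.prems[of f] by (auto simp: f gen_flower_def numeric_game_of)
    with Cons show ?case by (auto simp: flower_position_def f algebra_simps)
  qed (simp add: flower_position_def)
  then show "valid (flower_position fs)" "weight p (flower_position fs) = s * int (length fs)"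
    "count_pos p (flower_position fs) = (if s = 1 then length fs else 0)" by auto
qed

lemma valid_union: "valid (P + Q) \<longleftrightarrow> valid P \<and> valid Q"
  by (auto simp: valid_def)

lemma weight_union: "weight p (P + Q) = weight p P + weight p Q"
  by (simp add: weight_def)

lemma count_pos_union: "count_pos p (P + Q) = count_pos p P + count_pos p Q"
  by (simp add: count_pos_def)

theorem theorem4p19:
  fixes n :: nat
    and bs rs :: "('v, 'e) gen_flower list"
    and ss :: "nat list"
    and F :: game
  assumes "gen_flowerbed n bs rs"
    and "F = flowerbed_game bs rs ss"
    and "\<forall>f \<in> set bs. \<forall>g \<in> set rs. \<not> cancelling f g"
    and "\<exists>f \<in> set bs \<union> set rs. 2 \<le> fst f"
  shows "outcome Normal F = outcome Misere F \<and>
    (n \<ge> 2 \<longrightarrow> (\<forall>p. simultaneous_winning_move p F))"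
proof -
  let ?P = "flower_position bs + flower_position rs + stalk_position ss"
  have F: "F = val ?P"
    by (simp add: assms(2) flowerbed_game_def val_union val_flower_position val_stalk_position)
  have blue: "gen_flower f \<and> sign Left (game_of (snd f)) = 1" if "f \<in> set bs" for f
    using assms(1) that sign_blue by (auto simp: gen_flowerbed_def blue_flower_def blossom_value_def)
  have red: "gen_flower f \<and> sign Left (game_of (snd f)) = - 1" if "f \<in> set rs" for f
    using assms(1) that sign_red by (auto simp: gen_flowerbed_def red_flower_def blossom_value_def)
  have blue': "gen_flower f \<and> sign Right (game_of (snd f)) = - 1" if "f \<in> set bs" for f
    using blue[OF that] sign_opponent[of Left] by simp
  have red': "gen_flower f \<and> sign Right (game_of (snd f)) = 1" if "f \<in> set rs" for f
    using red[OF that] sign_opponent[of Left] by simp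
  have len: "length bs = n" "length rs = n" using assms(1) by (auto simp: gen_flowerbed_def)
  have valid: "valid ?P"
    using flower_position_simps(1)[OF blue] flower_position_simps(1)[OF red]
    by (simp add: valid_union stalk_position_simps)
  \<comment> \<open>Here the equal numbers of blue and red flowers enter; Stalks have sign
    zero.\<close>
  have weight: "weight p ?P = 0" for p
    using flower_position_simps(2)[OF blue] flower_position_simps(2)[OF red]
      flower_position_simps(2)[OF blue'] flower_position_simps(2)[OF red']
    by (cases p) (simp_all add: weight_union stalk_position_simps len)
  have count: "count_pos p ?P = n" for p
    using flower_position_simps(3)[OF blue] flower_position_simps(3)[OF red]
      flower_position_simps(3)[OF blue'] flower_position_simps(3)[OF red']
    by (cases p) (simp_all add: count_pos_union stalk_position_simps len)
  have tall: "tall_flower ?P"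
  proof -
    from assms(4) obtain h B where hB: "(h, B) \<in> set bs \<union> set rs" "2 \<le> h"
      by (metis prod.collapse)
    then have "(h, game_of B) \<in># ?P" by (force simp: flower_position_def)
    moreover have "sign Left (game_of B) \<noteq> 0" using hB(1) blue red by force
    ultimately show ?thesis using hB(2) by (auto simp: tall_flower_def)
  qed
  show ?thesis
    using outcome_val[OF valid tall] simultaneous_winning_move_val[OF valid weight _ tall]
    by (simp add: F count)
qed

end
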